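(* For any $c<1/2$, there is no randomized online algorithm that is $\mathcal{O}(\log^c(k/\sigma))$-competitive on general $\sigma$-smooth instances of $k$-server, of $k$-taxi, or of chasing small sets, even when restricted to instances in which the metric space is a ball in $O(\log k)$-dimensional $\ell_\infty$-space and all request distributions $D_t$ are identical and independent.
   Context: Metric setting: $M\subseteq\mathbb{R}^m$ of bounded diameter with metric induced by a norm; $B_M$ is a closed ball of smallest radius containing $M$. Problems: in $k$-server, $k$ servers in $M$ must serve requests $r_t\in M$ by moving a server to $r_t$, cost being total distance moved. In $k$-taxi, $k$ taxis serve requests $(a_t,b_t)\in M^2$ by moving a taxi to $a_t$ then to $b_t$, cost being total distance moved excluding the $a_t\to b_t$ trips. In chasing small sets, a single server must move to some point of each request $r_t\subseteq M$ with $|r_t|\le k$, cost being total distance moved. Smoothed instances: each request is drawn from a distribution $D_t$ (over $M$, $M^2$, or $M^{k_t}$ with $k_t\le k$, respectively), possibly chosen adaptively by the adversary based on earlier realized requests. For $\sigma\in(0,1]$ the instance is $\sigma$-smooth if every marginal distribution of every $D_t$ (each coordinate of the request) assigns to every measurable $S\subseteq M$ probability at most $\frac{1}{\sigma}\cdot\frac{\mathrm{vol}(S\cap B_M)}{\mathrm{vol}(B_M)}$. Competitive ratio: algorithm $A$ is $c$-competitive on $\sigma$-smooth instances if there is a constant $\alpha$ independent of the request sequence such that $\mathbb{E}[\mathrm{cost}(A,I)]\le c\cdot\mathbb{E}[\mathrm{cost}(\mathrm{OPT},I)]+\alpha$ for all $\sigma$-smooth instances $I$, where $\mathrm{OPT}$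 is the offline optimum knowing the realized request sequence, and expectations are over the randomness of the algorithm and of $I$. An algorithm is $\mathcal{O}(f(k,\sigma))$-competitive if it is $C\cdot f(k,\sigma)$-competitive for all $k$ and $\sigma$, for some absolute constant $C$. *)

theory Defs
  imports "HOL-Probability.Probability"
begin

(* The dimension must be able to grow with k inside the statement, so R^m is the space of the
   product measure over {..<m}: functions on {..<m}, extended by undefined.  Its sets are the
   Borel sets and its measure is the volume. *)

type_synonym point = "nat \<Rightarrow> real"

definition euc :: "nat \<Rightarrow> point measure" where
  "euc m = PiM {..<m} (\<lambda>_. lborel)"

definition is_norm :: "nat \<Rightarrow> (point \<Rightarrow> real) \<Rightarrow> bool" where
  "is_norm m N \<longleftrightarrow>
     (\<forall>x\<in>space (euc m). N x \<ge> 0 \<and> (N x = 0 \<longleftrightarrow> (\<forall>i<m. x i = 0))) \<and>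
     (\<forall>x\<in>space (euc m). \<forall>a::real. N (\<lambda>i\<in>{..<m}. a * x i) = \<bar>a\<bar> * N x) \<and>
     (\<forall>x\<in>space (euc m). \<forall>y\<in>space (euc m). N (\<lambda>i\<in>{..<m}. x i + y i) \<le> N x + N y)"

definition linf :: "nat \<Rightarrow> point \<Rightarrow> real" where
  "linf m x = Max ((\<lambda>i. \<bar>x i\<bar>) ` {..<m})"

definition norm_dist :: "nat \<Rightarrow> (point \<Rightarrow> real) \<Rightarrow> point \<Rightarrow> point \<Rightarrow> real" where
  "norm_dist m N x y = N (\<lambda>i\<in>{..<m}. x i - y i)"

definition norm_cball :: "nat \<Rightarrow> (point \<Rightarrow> real) \<Rightarrow> point \<Rightarrow> real \<Rightarrow> point set" where
  "norm_cball m N z \<rho> = {x \<in> space (euc m). norm_dist m N z x \<le> \<rho>}"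

record setting =
  dim :: nat
  nrm :: "point \<Rightarrow> real"
  pts :: "point set"

abbreviation sdist :: "setting \<Rightarrow> point \<Rightarrow> point \<Rightarrow> real" where
  "sdist X \<equiv> norm_dist (dim X) (nrm X)"

definition metric_setting :: "setting \<Rightarrow> bool" where
  "metric_setting X \<longleftrightarrow>
     dim X \<ge> 1 \<and> is_norm (dim X) (nrm X) \<and>
     pts X \<in> sets (euc (dim X)) \<and> pts X \<noteq> {} \<and>
     (\<exists>b. \<forall>x\<in>pts X. \<forall>y\<in>pts X. sdist X x y \<le> b)"

definition is_min_ball :: "setting \<Rightarrow> point set \<Rightarrow> bool" where
  "is_min_ball X B \<longleftrightarrow>
     (\<exists>z\<in>space (euc (dim X)). \<exists>\<rho>.
        B = norm_cball (dim X) (nrm X) z \<rho> \<and> pts X \<subseteq> B \<and>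
        (\<forall>z'\<in>space (euc (dim X)). \<forall>\<rho>'.
           pts X \<subseteq> norm_cball (dim X) (nrm X) z' \<rho>' \<longrightarrow> \<rho> \<le> \<rho>'))"

(* The ball need not be unique, but its volume is, and subsets of M lie in every such ball. *)
definition min_ball :: "setting \<Rightarrow> point set" where
  "min_ball X = (SOME B. is_min_ball X B)"

definition is_linf_ball :: "setting \<Rightarrow> bool" where
  "is_linf_ball X \<longleftrightarrow>
     dim X \<ge> 1 \<and> nrm X = linf (dim X) \<and>
     (\<exists>z\<in>space (euc (dim X)). \<exists>\<rho>>0. pts X = norm_cball (dim X) (nrm X) z \<rho>)"

(* Requests of all three problems are lists of points (elements of M^n): [r] for k-server,
   [a, b] for k-taxi, and between 1 and k points, possibly with repetitions, for chasing small
   sets.  A configuration lists the positions of the (labelled) servers or taxis; in chasing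
   small sets it has a single entry. *)

datatype problem = K_Server | K_Taxi | Chasing

type_synonym request = "point list"
type_synonym config = "point list"

fun request_lengths :: "problem \<Rightarrow> nat \<Rightarrow> nat set" where
  "request_lengths K_Server k = {1}"
| "request_lengths K_Taxi k = {2}"
| "request_lengths Chasing k = {1..k}"

fun num_servers :: "problem \<Rightarrow> nat \<Rightarrow> nat" where
  "num_servers K_Server k = k"
| "num_servers K_Taxi k = k"
| "num_servers Chasing k = 1"

definition configs :: "problem \<Rightarrow> nat \<Rightarrow> setting \<Rightarrow> config set" where
  "configs P k X = {s. length s = num_servers P k \<and> set s \<subseteq> pts X}"

(* The cost of going from s to s' while serving r.  Servers not used for r may move as well.
   In the taxi problem, taxi i serves (a, b) by driving from s ! i to a and then, for free, to b;
   several taxis may be at b in s', whence the infimum.  It is infinite if none is. *)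
fun serve_cost :: "problem \<Rightarrow> setting \<Rightarrow> config \<Rightarrow> request \<Rightarrow> config \<Rightarrow> ennreal" where
  "serve_cost K_Server X s r s' =
     (if r ! 0 \<in> set s' then \<Sum>i<length s. ennreal (sdist X (s ! i) (s' ! i)) else \<infinity>)"
| "serve_cost K_Taxi X s r s' =
     (INF i\<in>{i. i < length s \<and> s' ! i = r ! 1}.
        ennreal (sdist X (s ! i) (r ! 0)) +
        (\<Sum>j\<in>{..<length s} - {i}. ennreal (sdist X (s ! j) (s' ! j))))"
| "serve_cost Chasing X s r s' =
     (if s' ! 0 \<in> set r then ennreal (sdist X (s ! 0) (s' ! 0)) else \<infinity>)"

definition step_cost ::
    "problem \<Rightarrow> nat \<Rightarrow> setting \<Rightarrow> config \<Rightarrow> request \<Rightarrow> config \<Rightarrow> ennreal" where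
  "step_cost P k X s r s' = (if s' \<in> configs P k X then serve_cost P X s r s' else \<infinity>)"

definition path_cost ::
    "problem \<Rightarrow> nat \<Rightarrow> setting \<Rightarrow> nat \<Rightarrow> (nat \<Rightarrow> request) \<Rightarrow> (nat \<Rightarrow> config) \<Rightarrow> ennreal" where
  "path_cost P k X T r s = (\<Sum>t<T. step_cost P k X (s t) (r t) (s (Suc t)))"

definition opt_cost ::
    "problem \<Rightarrow> nat \<Rightarrow> setting \<Rightarrow> config \<Rightarrow> nat \<Rightarrow> (nat \<Rightarrow> request) \<Rightarrow> ennreal" where
  "opt_cost P k X s0 T r = (INF s\<in>{s. s 0 = s0}. path_cost P k X T r s)"

(* A randomized online algorithm draws a seed and then chooses each new configuration as a
   function of the seed, the initial configuration and the requests seen so far, the current one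
   included.  It may know k, sigma and the metric space; ignoring sigma is a special case.
   Infeasible decisions are ruled out by their infinite cost. *)
record 'w algorithm =
  seed :: "'w measure"
  decide :: "nat \<Rightarrow> real \<Rightarrow> setting \<Rightarrow> config \<Rightarrow> 'w \<Rightarrow> request list \<Rightarrow> config"

definition randomized_online_algorithm :: "'w algorithm \<Rightarrow> bool" where
  "randomized_online_algorithm A \<longleftrightarrow> prob_space (seed A)"

definition alg_path ::
    "nat \<Rightarrow> real \<Rightarrow> setting \<Rightarrow> 'w algorithm \<Rightarrow> config \<Rightarrow> 'w \<Rightarrow> (nat \<Rightarrow> request) \<Rightarrow> nat \<Rightarrow> config" where
  "alg_path k \<sigma> X A s0 w r t = (if t = 0 then s0 else decide A k \<sigma> X s0 w (map r [0..<t]))"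

definition alg_cost ::
    "problem \<Rightarrow> nat \<Rightarrow> real \<Rightarrow> setting \<Rightarrow> 'w algorithm \<Rightarrow> config \<Rightarrow> nat \<Rightarrow> 'w \<Rightarrow> (nat \<Rightarrow> request) \<Rightarrow> ennreal"
  where
  "alg_cost P k \<sigma> X A s0 T w r = path_cost P k X T r (alg_path k \<sigma> X A s0 w r)"

(* The disjoint union of the product spaces M^n over the admissible lengths n. *)
definition request_space :: "problem \<Rightarrow> nat \<Rightarrow> setting \<Rightarrow> request measure" where
  "request_space P k X =
     (let \<Omega> = {r. length r \<in> request_lengths P k \<and> set r \<subseteq> pts X}
      in sigma \<Omega> {{r \<in> \<Omega>. length r = n \<and> r ! i \<in> S} | n i S.
           i < n \<and> S \<in> sets (euc (dim X)) \<and> S \<subseteq> pts X})"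

definition smooth_distribution ::
    "problem \<Rightarrow> nat \<Rightarrow> real \<Rightarrow> setting \<Rightarrow> request measure \<Rightarrow> bool" where
  "smooth_distribution P k \<sigma> X D \<longleftrightarrow>
     (\<exists>n\<in>request_lengths P k. (AE r in D. length r = n) \<and>
        (\<forall>i<n. \<forall>S\<in>sets (euc (dim X)). S \<subseteq> pts X \<longrightarrow>
           measure D {r \<in> space D. length r = n \<and> r ! i \<in> S}
             \<le> 1 / \<sigma> * (measure (euc (dim X)) (S \<inter> min_ball X)
                        / measure (euc (dim X)) (min_ball X))))"

(* An adaptive adversary: D t h is the distribution of request t given the earlier realized
   requests h on {0..<t}.  The locale predicate says that the D t are probability kernels. *)
type_synonym adversary = "nat \<Rightarrow> (nat \<Rightarrow> request) \<Rightarrow> request measure"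

definition smooth_adversary ::
    "problem \<Rightarrow> nat \<Rightarrow> real \<Rightarrow> setting \<Rightarrow> adversary \<Rightarrow> bool" where
  "smooth_adversary P k \<sigma> X D \<longleftrightarrow>
     Ionescu_Tulcea D (\<lambda>_. request_space P k X) \<and>
     (\<forall>t. \<forall>h\<in>space (PiM {0..<t} (\<lambda>_. request_space P k X)). smooth_distribution P k \<sigma> X (D t h))"

definition iid_adversary :: "adversary \<Rightarrow> bool" where
  "iid_adversary D \<longleftrightarrow> (\<exists>D0. D = (\<lambda>_ _. D0))"

definition request_law ::
    "problem \<Rightarrow> nat \<Rightarrow> setting \<Rightarrow> adversary \<Rightarrow> nat \<Rightarrow> (nat \<Rightarrow> request) measure" where
  "request_law P k X D T =
     Ionescu_Tulcea.C D (\<lambda>_. request_space P k X) 0 T (\<lambda>_. undefined)"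

(* c-competitiveness on the smooth instances in the metric space X whose adversary satisfies Q.
   The additive constant may depend on everything but the request sequence.  The cost of the
   algorithm must be a random variable for its expectation to make sense. *)
definition competitive ::
    "problem \<Rightarrow> nat \<Rightarrow> real \<Rightarrow> setting \<Rightarrow> (adversary \<Rightarrow> bool) \<Rightarrow> 'w algorithm \<Rightarrow> real \<Rightarrow> bool" where
  "competitive P k \<sigma> X Q A c \<longleftrightarrow>
     (\<forall>s0\<in>configs P k X. \<exists>\<alpha>::real. \<forall>D T. smooth_adversary P k \<sigma> X D \<and> Q D \<longrightarrow>
        (\<lambda>(w, r). alg_cost P k \<sigma> X A s0 T w r)
          \<in> borel_measurable (seed A \<Otimes>\<^sub>M request_law P k X D T) \<and>
        (\<integral>\<^sup>+(w, r). alg_cost P k \<sigma> X A s0 T w r \<partial>(seed A \<Otimes>\<^sub>M request_law P k X D T))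
          \<le> ennreal c * (\<integral>\<^sup>+r. opt_cost P k X s0 T r \<partial>request_law P k X D T) + ennreal \<alpha>)"

(* O(f)-competitiveness on the instances selected by I.  The range k >= 2 keeps log (k/sigma)
   bounded away from 0; at k = sigma = 1 it vanishes, and no algorithm at all would be
   O(log^c (k/sigma))-competitive there for c > 0. *)
definition O_competitive ::
    "problem \<Rightarrow> (nat \<Rightarrow> setting \<Rightarrow> adversary \<Rightarrow> bool) \<Rightarrow> 'w algorithm \<Rightarrow> (nat \<Rightarrow> real \<Rightarrow> real) \<Rightarrow> bool"
  where
  "O_competitive P I A f \<longleftrightarrow>
     (\<exists>C>0. \<forall>k\<ge>2. \<forall>\<sigma>. 0 < \<sigma> \<and> \<sigma> \<le> 1 \<longrightarrow>
        (\<forall>X. metric_setting X \<longrightarrow> competitive P k \<sigma> X (I k X) A (C * f k \<sigma>)))"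

end

(* The requests are noisy points: a corner of {-1, 1}^m is chosen uniformly, N = k + 1 = 2^m, and
   translated by a uniform vector of [0, eps]^m.  Up to noise this is paging with k + 1 pages and
   uniform requests, where an online algorithm pays 1 / (k + 1) per request, but an offline
   algorithm only about 1 / (k log k): during (N log_2 N) / 4 requests some corner is most likely
   not requested at all (coupon collecting), and the offline algorithm keeps its uncovered corner
   there.  The noise costs at most k * eps per request, so eps = N^(-3) is harmless, while
   log (k / sigma) is of order m log (1 / eps), that is, log^2 k. *)

theory Submission
  imports Defs
begin

section \<open>Geometry of the cube\<close>

text \<open>In the \<open>linf\<close> norm all \<open>2 ^ m\<close> corners have pairwise distance
  2, so a uniform metric on k + 1 points fits into dimension log_2 (k + 1) and leaves room for the
  noise. The ratio is then of order log k, the square root of log (k / sigma): this is the exponent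
  1/2. Online servers may stand anywhere in the cube, but each is near at most one corner, so by
  pigeonhole some corner is far from all of them. Offline play only has to be bounded from above, so
  it is restricted to configurations that cover all corners but one. What remains is a hole on
  \<open>N\<close> spots that avoids the requested spot, and this also describes chasing. Its cost
  is subadditive, so only one block of requests has to be estimated. The obstacle is measurability:
  \<open>opt_cost\<close> is an infimum over all schedules, and single decisions of an algorithm are
  arbitrary functions. Expectations are therefore compared by peeling off the last request, not by
  coupling the requests with the sequence of corners.\<close>

lemma norm_dist_linf_le_iff:
  assumes "m \<ge> 1"
  shows "norm_dist m (linf m) x y \<le> r \<longleftrightarrow> (\<forall>i<m. \<bar>x i - y i\<bar> \<le> r)"
proof -
  have "{..<m} \<noteq> {}" using assms by (simp add: lessThan_empty_iff)
  then show ?thesis by (auto simp: norm_dist_def linf_def)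
qed

lemma coord_le_norm_dist_linf: "i < m \<Longrightarrow> \<bar>x i - y i\<bar> \<le> norm_dist m (linf m) x y"
  using norm_dist_linf_le_iff[of m x y "norm_dist m (linf m) x y"] by auto

lemma norm_dist_linf_commute: "norm_dist m (linf m) x y = norm_dist m (linf m) y x"
  by (simp add: norm_dist_def linf_def abs_minus_commute)

lemma norm_dist_linf_triangle:
  assumes "m \<ge> 1"
  shows "norm_dist m (linf m) x z \<le> norm_dist m (linf m) x y + norm_dist m (linf m) y z"
proof (subst norm_dist_linf_le_iff[OF assms], intro allI impI)
  fix i assume "i < m"
  then have "\<bar>x i - y i\<bar> \<le> norm_dist m (linf m) x y" "\<bar>y i - z i\<bar> \<le> norm_dist m (linf m) y z"
    by (auto intro: coord_le_norm_dist_linf)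
  then show "\<bar>x i - z i\<bar> \<le> norm_dist m (linf m) x y + norm_dist m (linf m) y z" by linarith
qed

lemma is_norm_linf:
  assumes "m \<ge> 1"
  shows "is_norm m (linf m)"
proof -
  have ne: "{..<m} \<noteq> {}" using assms by (simp add: lessThan_empty_iff)
  have le: "linf m x \<le> r \<longleftrightarrow> (\<forall>i<m. \<bar>x i\<bar> \<le> r)" for x r
    using ne by (auto simp: linf_def)
  have ge: "\<bar>x i\<bar> \<le> linf m x" if "i < m" for x i
    using le[of x "linf m x"] that by auto
  have nonneg: "0 \<le> linf m x" for x using ge[of 0 x] assms by auto
  have zero: "linf m x = 0 \<longleftrightarrow> (\<forall>i<m. x i = 0)" for x
    using le[of x 0] nonneg[of x] by auto
  have "linf m (\<lambda>i\<in>{..<m}. a * x i) = \<bar>a\<bar> * linf m x" for a x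
  proof -
    have "(\<lambda>i. \<bar>(\<lambda>i\<in>{..<m}. a * x i) i\<bar>) ` {..<m} = (\<lambda>y. \<bar>a\<bar> * y) ` ((\<lambda>i. \<bar>x i\<bar>) ` {..<m})"
      by (auto simp: abs_mult image_image)
    moreover have "mono (\<lambda>y. \<bar>a\<bar> * y)" by (intro monoI mult_left_mono) auto
    ultimately show ?thesis
      using ne mono_Max_commute[of "\<lambda>y. \<bar>a\<bar> * y" "(\<lambda>i. \<bar>x i\<bar>) ` {..<m}"] by (simp add: linf_def)
  qed
  moreover have "linf m (\<lambda>i\<in>{..<m}. x i + y i) \<le> linf m x + linf m y" for x y
    unfolding le using ge[of _ x] ge[of _ y] by (force intro: order_trans[OF abs_triangle_ineq add_mono])
  ultimately show ?thesis using nonneg zero by (auto simp: is_norm_def)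
qed

lemma space_euc: "space (euc m) = extensional {..<m}"
  by (simp add: euc_def space_PiM PiE_def)

lemma norm_cball_linf:
  assumes "m \<ge> 1"
  shows "norm_cball m (linf m) z \<rho> = PiE {..<m} (\<lambda>i. {z i - \<rho>..z i + \<rho>})"
  by (auto simp: norm_cball_def norm_dist_linf_le_iff[OF assms] space_euc PiE_def Pi_iff abs_le_iff
      algebra_simps)

interpretation lborel_prod: product_sigma_finite "\<lambda>_::nat. lborel :: real measure" ..

lemma emeasure_euc_box:
  assumes "\<And>i. i < m \<Longrightarrow> a i \<le> b i"
  shows "emeasure (euc m) (PiE {..<m} (\<lambda>i. {a i..b i})) = ennreal (\<Prod>i<m. b i - a i)"
  using assms unfolding euc_def
  by (subst lborel_prod.emeasure_PiM) (auto intro!: prod_ennreal prod.cong)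

lemma box_in_sets_euc: "PiE {..<m} (\<lambda>i. {a i..b i}) \<in> sets (euc m)"
  unfolding euc_def by (intro sets_PiM_I_finite) auto

text \<open>Radius 2 leaves room for the corners of {-1, 1}^m with noise up to 1/2 and makes the
  volume \<open>4 ^ m\<close>.\<close>

definition cube :: "nat \<Rightarrow> setting" where
  "cube m = \<lparr>dim = m, nrm = linf m, pts = norm_cball m (linf m) (\<lambda>i\<in>{..<m}. 0) 2\<rparr>"

lemma cube_simps [simp]: "dim (cube m) = m" "nrm (cube m) = linf m"
  by (simp_all add: cube_def)

lemma pts_cube: "m \<ge> 1 \<Longrightarrow> pts (cube m) = PiE {..<m} (\<lambda>_. {-2..2})"
  by (auto simp: cube_def norm_cball_linf intro!: PiE_cong)

lemma is_linf_ball_cube: "m \<ge> 1 \<Longrightarrow> is_linf_ball (cube m)"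
  unfolding is_linf_ball_def
  by (auto simp: cube_def space_euc intro!: bexI[of _ "\<lambda>i\<in>{..<m}. 0"] exI[of _ 2])

lemma metric_setting_cube:
  assumes "m \<ge> 1"
  shows "metric_setting (cube m)"
proof -
  have "sdist (cube m) x y \<le> 4" if "x \<in> pts (cube m)" "y \<in> pts (cube m)" for x y
  proof -
    have "\<bar>x i - y i\<bar> \<le> 4" if "i < m" for i
    proof -
      have "x i \<in> {-2..2}" "y i \<in> {-2..2}"
        using \<open>i < m\<close> \<open>x \<in> _\<close> \<open>y \<in> _\<close> unfolding pts_cube[OF assms]
        by (fastforce dest: PiE_mem)+
      then show ?thesis by auto
    qed
    then show ?thesis by (simp add: norm_dist_linf_le_iff[OF assms])
  qed
  moreover have "pts (cube m) \<noteq> {}" by (simp add: pts_cube[OF assms] PiE_eq_empty_iff)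
  ultimately show ?thesis
    using assms box_in_sets_euc[of m "\<lambda>_. -2" "\<lambda>_. 2"]
    unfolding metric_setting_def
    by (intro conjI exI[of _ 4] ballI) (simp_all add: is_norm_linf pts_cube)
qed

text \<open>\<open>min_ball\<close> is an arbitrary choice among the smallest balls, so the proof
  determines only its radius, which fixes the volume.\<close>

lemma min_ball_cube:
  assumes "m \<ge> 1"
  shows "pts (cube m) \<subseteq> min_ball (cube m)"
    and "0 < measure (euc m) (min_ball (cube m))"
    and "measure (euc m) (min_ball (cube m)) \<le> 4 ^ m"
proof -
  let ?X = "cube m" and ?O = "\<lambda>i\<in>{..<m}. 0 :: real"
  have O: "?O \<in> space (euc m)" by (simp add: space_euc)
  have pts: "pts ?X = norm_cball m (linf m) ?O 2" by (simp add: cube_def)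
  have min: "2 \<le> \<rho>" if "pts ?X \<subseteq> norm_cball m (linf m) z \<rho>" for z \<rho>
  proof -
    have "(\<lambda>i\<in>{..<m}. s) \<in> pts ?X" if "s \<in> {-2..2}" for s
      unfolding pts_cube[OF assms] using that by simp
    then have "(\<lambda>i\<in>{..<m}. s) \<in> PiE {..<m} (\<lambda>i. {z i - \<rho>..z i + \<rho>})" if "s \<in> {-2..2}" for s
      using that subsetD[OF \<open>pts ?X \<subseteq> _\<close>] unfolding norm_cball_linf[OF assms] by metis
    \<comment> \<open>The constant points 2 and -2 differ by 4 in coordinate 0, so an enclosing ball
      has radius at least 2.\<close>
    from this[of 2, THEN PiE_mem, of 0] this[of "-2", THEN PiE_mem, of 0] show ?thesis
      using assms by simp
  qed
  have "is_min_ball ?X (pts ?X)"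
    unfolding is_min_ball_def using O min pts
    by (intro bexI[of _ ?O] exI[of _ 2]) simp_all
  then have "is_min_ball ?X (min_ball ?X)"
    unfolding min_ball_def by (rule someI)
  then obtain z \<rho> where B: "min_ball ?X = norm_cball m (linf m) z \<rho>" and sub: "pts ?X \<subseteq> min_ball ?X"
    and "\<rho> \<le> 2"
    unfolding is_min_ball_def using O by (metis cube_simps order_refl pts)
  moreover have "2 \<le> \<rho>" using min sub B by metis
  ultimately have "\<rho> = 2" by simp
  then have "emeasure (euc m) (min_ball ?X) = ennreal (4 ^ m)"
    unfolding B norm_cball_linf[OF assms] by (subst emeasure_euc_box) auto
  then have "measure (euc m) (min_ball ?X) = 4 ^ m"
    by (simp add: measure_def)
  then show "pts ?X \<subseteq> min_ball ?X" "0 < measure (euc m) (min_ball ?X)"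
    "measure (euc m) (min_ball ?X) \<le> 4 ^ m" using sub by auto
qed

section \<open>Moving a hole\<close>

primrec moves :: "'a \<Rightarrow> 'a list \<Rightarrow> nat" where
  "moves h [] = 0"
| "moves h (x # xs) = of_bool (h \<noteq> x) + moves x xs"

lemma moves_append: "moves h (xs @ ys) = moves h xs + moves (last (h # xs)) ys"
  by (induction xs arbitrary: h) auto

lemma moves_conv_sum: "moves h hs = (\<Sum>t<length hs. of_bool ((h # hs) ! t \<noteq> hs ! t))"
  by (induction hs arbitrary: h) (simp_all add: sum.lessThan_Suc_shift del: sum.lessThan_Suc)

text \<open>The bound has to hold from every starting hole \<open>h\<close>, so that it does not
  matter where the preceding block of requests left the hole. This makes \<open>hole_cost\<close>
  subadditive.\<close>

definition avoidable :: "nat \<Rightarrow> nat list \<Rightarrow> nat \<Rightarrow> bool" where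
  "avoidable N js n \<longleftrightarrow>
     (\<forall>h<N. \<exists>hs. list_all2 (\<noteq>) hs js \<and> set hs \<subseteq> {..<N} \<and> moves h hs \<le> n)"

definition hole_cost :: "nat \<Rightarrow> nat list \<Rightarrow> nat" where
  "hole_cost N js = (LEAST n. avoidable N js n)"

text \<open>The hole stays at \<open>i\<close> and leaves it for one step whenever \<open>i\<close> is requested.\<close>

lemma avoidable_count:
  assumes "N \<ge> 2" "i < N"
  shows "avoidable N js (1 + 2 * count_list js i)"
proof -
  define alt where "alt = (if i = 0 then 1 else 0 :: nat)"
  define hs where "hs = map (\<lambda>j. if j \<noteq> i then i else alt) js"
  have alt: "alt \<noteq> i" "alt < N" using assms by (auto simp: alt_def)
  have "list_all2 (\<noteq>) hs js" using alt by (auto simp: hs_def list_all2_conv_all_nth)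
  moreover have "set hs \<subseteq> {..<N}" using alt assms by (auto simp: hs_def)
  \<comment> \<open>The first term pays for reaching \<open>i\<close>; every request of
    \<open>i\<close> pays for one move to \<open>alt\<close> and one move back.\<close>
  moreover have "moves h hs \<le> of_bool (h \<noteq> i) + 2 * count_list js i" for h
    unfolding hs_def
  proof (induction js arbitrary: h)
    case (Cons j js)
    show ?case using Cons.IH[of i] Cons.IH[of alt] alt(1) by auto
  qed simp
  then have "moves h hs \<le> 1 + 2 * count_list js i" for h
    by (rule order_trans) auto
  ultimately show ?thesis unfolding avoidable_def by blast
qed

lemma avoidable_hole_cost: "N \<ge> 2 \<Longrightarrow> avoidable N js (hole_cost N js)"
  unfolding hole_cost_def using avoidable_count[of N 0] by (intro LeastI) auto

lemma hole_cost_le_count: "N \<ge> 2 \<Longrightarrow> i < N \<Longrightarrow> hole_cost N js \<le> 1 + 2 * count_list js i"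
  unfolding hole_cost_def by (intro Least_le avoidable_count)

lemma hole_cost_append:
  assumes "N \<ge> 2"
  shows "hole_cost N (xs @ ys) \<le> hole_cost N xs + hole_cost N ys"
  unfolding hole_cost_def[of N "xs @ ys"]
proof (rule Least_le, unfold avoidable_def, intro allI impI)
  fix h assume "h < N"
  obtain hs where hs: "list_all2 (\<noteq>) hs xs" "set hs \<subseteq> {..<N}" "moves h hs \<le> hole_cost N xs"
    using avoidable_hole_cost[OF assms, of xs] \<open>h < N\<close> by (auto simp: avoidable_def)
  have "last (h # hs) \<in> set (h # hs)" by (rule last_in_set) simp
  then have "last (h # hs) < N" using hs(2) \<open>h < N\<close> by auto
  then obtain hs' where hs': "list_all2 (\<noteq>) hs' ys" "set hs' \<subseteq> {..<N}"
      "moves (last (h # hs)) hs' \<le> hole_cost N ys"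
    using avoidable_hole_cost[OF assms, of ys] by (auto simp: avoidable_def)
  show "\<exists>hs. list_all2 (\<noteq>) hs (xs @ ys) \<and> set hs \<subseteq> {..<N} \<and> moves h hs \<le> hole_cost N xs + hole_cost N ys"
    using hs hs' by (intro exI[of _ "hs @ hs'"])
      (auto simp: moves_append simp del: last.simps intro: list_all2_appendI)
qed

section \<open>Coupon collecting\<close>

lemma prob_replicate_pmf_subset:
  "measure_pmf.prob (replicate_pmf L p) {js. set js \<subseteq> A} = measure_pmf.prob p A ^ L"
proof (induction L)
  case (Suc L)
  let ?S = "{js. set js \<subseteq> A}"
  have "emeasure (replicate_pmf (Suc L) p) ?S = (\<integral>\<^sup>+js. indicator ?S js \<partial>replicate_pmf (Suc L) p)"
    by simp
  also have "\<dots> = (\<integral>\<^sup>+x. (\<integral>\<^sup>+xs. indicator ?S (x # xs) \<partial>replicate_pmf L p) \<partial>p)"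
    by (simp del: nn_integral_indicator)
  also have "\<dots> = (\<integral>\<^sup>+x. (\<integral>\<^sup>+xs. indicator A x * indicator ?S xs \<partial>replicate_pmf L p) \<partial>p)"
    by (intro nn_integral_cong) (auto split: split_indicator)
  also have "\<dots> = emeasure p A * emeasure (replicate_pmf L p) ?S"
    by (simp add: nn_integral_cmult nn_integral_multc)
  finally show ?case
    using Suc by (simp add: measure_pmf.emeasure_eq_measure ennreal_mult[symmetric] del: replicate_pmf.simps)
qed simp

abbreviation coupons :: "nat \<Rightarrow> nat \<Rightarrow> nat list pmf" where
  "coupons N L \<equiv> replicate_pmf L (pmf_of_set {..<N})"

lemma prob_coupons_avoid:
  assumes "N > 0" "I \<subseteq> {..<N}"
  shows "measure_pmf.prob (coupons N L) {js. set js \<inter> I = {}} = (1 - card I / N) ^ L"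
proof -
  have ne: "{..<N} \<noteq> {}" using assms by auto
  have "finite I" using assms(2) finite_subset by blast
  have le: "card I \<le> N" using card_mono[OF _ assms(2)] by simp
  have "measure_pmf.prob (pmf_of_set {..<N}) (- I) = (real N - card I) / N"
    using ne assms le \<open>finite I\<close>
    by (simp add: measure_pmf_of_set Diff_eq[symmetric] card_Diff_subset of_nat_diff)
  also have "\<dots> = 1 - card I / N" using assms by (simp add: field_simps)
  moreover have "{js. set js \<inter> I = {}} = {js. set js \<subseteq> - I}" by auto
  ultimately show ?thesis using prob_replicate_pmf_subset[of L "pmf_of_set {..<N}" "- I"] by simp
qed

text \<open>Finite support makes every real function of the draws integrable, as the second moment
  computation requires.\<close>

lemma finite_set_coupons: "N > 0 \<Longrightarrow> finite (set_pmf (coupons N L))"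
  using finite_lists_length_eq[of "{..<N}" L]
  by (simp add: set_replicate_pmf in_lists_conv_set subset_eq lessThan_empty_iff)

text \<open>Second moment method for the number of coupons that were not drawn.\<close>

lemma prob_coupons_complete:
  assumes "N \<ge> 2"
  shows "measure_pmf.prob (coupons N L) {js. {..<N} \<subseteq> set js} \<le> 1 / (N * (1 - 1 / N) ^ L)"
proof -
  let ?p = "coupons N L"
  define q where "q = (1 - 1 / real N) ^ L"
  define q2 where "q2 = (1 - 2 / real N) ^ L"
  define \<mu> where "\<mu> = N * q"
  define X where "X = (\<lambda>js. \<Sum>i<N. indicator {js. i \<notin> set js} js :: real)"
  have N: "N > 0" using assms by simp
  have int [simp]: "integrable (measure_pmf ?p) f" for f :: "nat list \<Rightarrow> real"
    by (rule integrable_measure_pmf_finite[OF finite_set_coupons[OF N]])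
  have q: "q > 0" using assms by (simp add: q_def)
  have "\<mu> > 0" using q N by (simp add: \<mu>_def)
  have "0 \<le> 1 - 2 / real N" using assms by (simp add: field_simps)
  \<comment> \<open>The two sides differ by \<open>1 / N ^ 2\<close>. Hence
    \<open>q2 \<le> q ^ 2\<close>: the events that two given coupons are missing are negatively
    correlated, and the variance of \<open>X\<close> is at most its mean.\<close>
  moreover have "1 - 2 / real N \<le> (1 - 1 / N) ^ 2" by (simp add: power2_eq_square algebra_simps)
  ultimately have "q2 \<le> q ^ 2"
    unfolding q_def q2_def power_mult[symmetric] mult.commute[of L] by (simp add: power_mult power_mono)
  have single: "measure_pmf.prob ?p {js. i \<notin> set js} = q" if "i < N" for i
    using prob_coupons_avoid[OF N, of "{i}" L] that by (simp add: q_def)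
  have pair: "measure_pmf.prob ?p ({js. i \<notin> set js} \<inter> {js. j \<notin> set js}) = (if i = j then q else q2)"
    if "i < N" "j < N" for i j
    using prob_coupons_avoid[OF N, of "{i, j}" L] single[of i] that
    by (auto simp: q2_def Collect_conj_eq[symmetric])
  have EX: "measure_pmf.expectation ?p X = \<mu>"
    unfolding X_def by (subst Bochner_Integration.integral_sum) (simp_all add: single \<mu>_def)
  have "measure_pmf.expectation ?p (\<lambda>js. (X js)\<^sup>2) =
      (\<Sum>i<N. \<Sum>j<N. measure_pmf.prob ?p ({js. i \<notin> set js} \<inter> {js. j \<notin> set js}))"
    unfolding X_def power2_eq_square sum_product
    by (simp add: Bochner_Integration.integral_sum indicator_inter_arith[symmetric])
  also have "\<dots> = (\<Sum>i<N. \<Sum>j<N. q2 + of_bool (i = j) * (q - q2))"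
    by (intro sum.cong) (auto simp: pair)
  also have "\<dots> = (\<Sum>i<N. N * q2 + (q - q2))"
    by (intro sum.cong) (simp_all add: sum.distrib sum_distrib_right[symmetric] of_bool_def)
  also have "\<dots> = N * (N * q2 + (q - q2))" by simp
  also have "\<dots> = N * (N - 1) * q2 + N * q" using N by (simp add: algebra_simps of_nat_diff)
  also have "\<dots> \<le> N * (N - 1) * q ^ 2 + N * q"
    using \<open>q2 \<le> q ^ 2\<close> by (intro add_right_mono mult_left_mono) auto
  also have "\<dots> \<le> \<mu>\<^sup>2 + \<mu>"
    using N q by (simp add: \<mu>_def power2_eq_square algebra_simps of_nat_diff)
  finally have var: "measure_pmf.variance ?p X \<le> \<mu>"
    by (subst measure_pmf.variance_eq) (simp_all add: EX)
  \<comment> \<open>If no coupon is missing, \<open>X\<close> is 0 and deviates by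
    \<open>\<mu>\<close> from its mean; Chebyshev with variance at most \<open>\<mu>\<close> gives
    \<open>1 / \<mu>\<close>.\<close>
  have "measure_pmf.prob ?p {js. {..<N} \<subseteq> set js} \<le>
      measure_pmf.prob ?p {js \<in> space ?p. \<mu> \<le> \<bar>X js - measure_pmf.expectation ?p X\<bar>}"
    unfolding EX by (rule measure_pmf.finite_measure_mono) (auto simp: X_def subset_eq)
  also have "\<dots> \<le> measure_pmf.variance ?p X / \<mu>\<^sup>2"
    by (rule measure_pmf.Chebyshev_inequality) (auto simp: \<open>\<mu> > 0\<close>)
  also have "\<dots> \<le> \<mu> / \<mu>\<^sup>2" by (intro divide_right_mono var) simp
  also have "\<dots> = 1 / (N * (1 - 1 / N) ^ L)"
    using \<open>\<mu> > 0\<close> by (simp add: power2_eq_square \<mu>_def q_def)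
  finally show ?thesis .
qed

text \<open>Pigeonhole: the request counts of the \<open>N\<close> spots add up to
  \<open>a * N\<close>, so one of them is at most \<open>a\<close>.\<close>

lemma hole_cost_le_average:
  assumes "N \<ge> 2" "set js \<subseteq> {..<N}" "length js = a * N"
  shows "hole_cost N js \<le> 1 + 2 * a"
proof -
  have "(\<Sum>i<N. count_list js i) = (\<Sum>i\<in>set js. count_list js i)"
    using assms by (intro sum.mono_neutral_right) (auto simp: count_list_0_iff)
  also have "\<dots> = (\<Sum>i<N. a)" using assms(3) by (simp add: sum_count_set)
  finally have "\<not> (\<Sum>i<N. a) < (\<Sum>i<N. count_list js i)" by simp
  then obtain i where "i < N" "count_list js i \<le> a"
    using sum_strict_mono[of "{..<N}" "\<lambda>_. a" "count_list js"] assms(1)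
    by (metis finite_lessThan lessThan_iff lessThan_empty_iff not_le_imp_less not_numeral_le_zero)
  then show ?thesis using hole_cost_le_count[OF assms(1), of i js] by linarith
qed

text \<open>The least requested spot gets at most \<open>a\<close> of the \<open>a N = (N log\<^sub>2 N) / 4\<close> requests, and
  none unless all coupons are drawn, which has probability at most \<open>4\<^sup>-\<^sup>a\<close>.\<close>

lemma expected_hole_cost_block:
  assumes "a \<ge> 1" "N = 16 ^ a"
  shows "(\<integral>\<^sup>+js. ennreal (hole_cost N js) \<partial>coupons N (a * N)) \<le> 3"
proof -
  let ?p = "coupons N (a * N)" and ?C = "{js. {..<N} \<subseteq> set js}"
  have "(16::nat) ^ 1 \<le> 16 ^ a" using assms(1) by (intro power_increasing) auto
  then have N: "N \<ge> 2" using assms by simp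
  have pt: "hole_cost N js \<le> 1 + 2 * a * indicator ?C js" if "js \<in> set_pmf ?p" for js
  proof (cases "js \<in> ?C")
    case True
    then show ?thesis
      using hole_cost_le_average[OF N, of js a] that N by (auto simp: set_replicate_pmf lessThan_empty_iff)
  next
    case False
    then obtain i where "i < N" "i \<notin> set js" by auto
    then show ?thesis
      using hole_cost_le_count[OF N, of i js] False by (simp add: count_list_0_iff)
  qed
  have "1 / 4 \<le> (1 - 1 / real N) ^ N"
  proof -
    \<comment> \<open>Bernoulli on all \<open>N\<close> factors would only give 0; on half of them
      it gives 1/2, which is then squared.\<close>
    obtain M where M: "N = 2 * M"
      using assms by (metis dvdE even_numeral dvd_power One_nat_def Suc_le_eq dvd_trans)
    have "1 / 2 = 1 + real M * (- 1 / real N)" using N by (simp add: M)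
    also have "\<dots> \<le> (1 + (- 1 / real N)) ^ M" using N by (intro Bernoulli_inequality) simp
    finally have "(1 / 2) ^ 2 \<le> ((1 - 1 / real N) ^ M) ^ 2" by (intro power_mono) simp_all
    then show ?thesis
      unfolding power_mult[symmetric] using M by (simp add: mult.commute power2_eq_square)
  qed
  then have "(1 / 4) ^ a \<le> ((1 - 1 / real N) ^ N) ^ a" by (intro power_mono) auto
  \<comment> \<open>This bounds the expected number of missing coupons from below. With base 16 it
    is at least \<open>4 ^ a\<close>, enough to outweigh the worst case \<open>1 + 2 * a\<close> of
    the hole cost.\<close>
  then have "16 ^ a * (1 / 4) ^ a \<le> N * (1 - 1 / real N) ^ (a * N)"
    unfolding assms(2) by (simp add: power_mult[symmetric] mult.commute mult_left_mono)
  then have "4 ^ a \<le> N * (1 - 1 / real N) ^ (a * N)" by (simp add: power_mult_distrib[symmetric])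
  then have "1 / (N * (1 - 1 / real N) ^ (a * N)) \<le> 1 / 4 ^ a"
    using N by (intro divide_left_mono mult_pos_pos zero_less_power) simp_all
  then have cov: "measure_pmf.prob ?p ?C \<le> 1 / 4 ^ a"
    using prob_coupons_complete[OF N, of "a * N"] by linarith
  have "real a \<le> 4 ^ a"
    using Bernoulli_inequality[of 3 a] by simp
  then have "2 * real a * (1 / 4 ^ a) \<le> 2" by (simp add: field_simps)
  then have a: "2 * real a * measure_pmf.prob ?p ?C \<le> 2"
    using mult_left_mono[OF cov, of "2 * real a"] by linarith
  have "(\<integral>\<^sup>+js. ennreal (hole_cost N js) \<partial>?p) \<le> (\<integral>\<^sup>+js. 1 + ennreal (2 * a) * indicator ?C js \<partial>?p)"
  proof (intro nn_integral_mono_AE AE_pmfI)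
    fix js assume "js \<in> set_pmf ?p"
    then have "ennreal (hole_cost N js) \<le> ennreal (1 + 2 * a * indicator ?C js)"
      using pt[of js] by (intro ennreal_leI) (cases "js \<in> ?C"; simp)
    also have "\<dots> = 1 + ennreal (2 * a) * indicator ?C js"
      by (auto split: split_indicator simp: ennreal_plus)
    finally show "ennreal (hole_cost N js) \<le> 1 + ennreal (2 * a) * indicator ?C js" .
  qed
  also have "\<dots> = 1 + ennreal (2 * a) * emeasure ?p ?C"
    by (simp add: nn_integral_add nn_integral_cmult_indicator)
  also have "\<dots> = ennreal (1 + 2 * a * measure_pmf.prob ?p ?C)"
    by (simp add: measure_pmf.emeasure_eq_measure ennreal_plus ennreal_mult)
  also have "\<dots> \<le> ennreal 3"
    using a by (intro ennreal_leI) simp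
  finally show ?thesis by simp
qed

text \<open>Independence of consecutive draws; it serves to split off a whole block of requests, and
  later a single last request.\<close>

lemma nn_integral_coupons_append:
  "(\<integral>\<^sup>+js. g js \<partial>coupons N (L + L')) = (\<integral>\<^sup>+xs. (\<integral>\<^sup>+ys. g (xs @ ys) \<partial>coupons N L') \<partial>coupons N L)"
  by (simp add: replicate_pmf_distrib)

lemma expected_hole_cost:
  assumes "a \<ge> 1" "N = 16 ^ a"
  shows "(\<integral>\<^sup>+js. ennreal (hole_cost N js) \<partial>coupons N (B * (a * N))) \<le> ennreal (1 + 3 * B)"
proof (induction B)
  case 0
  have "(16::nat) ^ 1 \<le> 16 ^ a" using assms(1) by (intro power_increasing) auto
  \<comment> \<open>The additive 1 of the claim is this bound for the empty sequence; it will be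
    absorbed by the additive constant of competitiveness.\<close>
  then have "hole_cost N [] \<le> 1" using hole_cost_le_count[of N 0 "[]"] assms by simp
  then show ?case by (simp add: nn_integral_return ennreal_leI)
next
  case (Suc B)
  let ?L = "a * N"
  have "(16::nat) ^ 1 \<le> 16 ^ a" using assms(1) by (intro power_increasing) auto
  then have N: "N \<ge> 2" using assms by simp
  have "Suc B * ?L = B * ?L + ?L" by simp
  then have "(\<integral>\<^sup>+js. ennreal (hole_cost N js) \<partial>coupons N (Suc B * ?L)) =
      (\<integral>\<^sup>+xs. (\<integral>\<^sup>+ys. ennreal (hole_cost N (xs @ ys)) \<partial>coupons N ?L) \<partial>coupons N (B * ?L))"
    by (simp only: nn_integral_coupons_append)
  also have "\<dots> \<le> (\<integral>\<^sup>+xs. (\<integral>\<^sup>+ys. ennreal (hole_cost N xs) + ennreal (hole_cost N ys) \<partial>coupons N ?L)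
      \<partial>coupons N (B * ?L))"
    using hole_cost_append[OF N]
    by (intro nn_integral_mono) (simp add: ennreal_plus[symmetric] of_nat_add[symmetric] ennreal_leI
        del: ennreal_plus of_nat_add)
  also have "\<dots> = (\<integral>\<^sup>+js. ennreal (hole_cost N js) \<partial>coupons N (B * ?L)) +
      (\<integral>\<^sup>+js. ennreal (hole_cost N js) \<partial>coupons N ?L)"
    by (simp add: nn_integral_add)
  also have "\<dots> \<le> ennreal (1 + 3 * B) + ennreal 3"
    using Suc expected_hole_cost_block[OF assms] by (intro add_mono) auto
  also have "\<dots> = ennreal (1 + 3 * Suc B)" by (subst ennreal_plus[symmetric]) simp_all
  finally show ?case .
qed

section \<open>The hard instance\<close>

text \<open>Translation invariance of the volume: a measure on the finite product is determined by
  its values on boxes, and there the invariance of \<open>lborel\<close> applies in each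
  coordinate.\<close>

lemma distr_euc_translate:
  "distr (euc m) (euc m) (\<lambda>u. \<lambda>x\<in>{..<m}. c x + u x) = euc m" (is "?D = _")
proof -
  have meas: "(\<lambda>u. \<lambda>x\<in>{..<m}. c x + u x) \<in> measurable (euc m) (euc m)"
    unfolding euc_def by measurable
  have "?D = PiM {..<m} (\<lambda>_. lborel)"
  proof (rule lborel_prod.PiM_eqI)
    fix A :: "nat \<Rightarrow> real set" assume A: "\<And>i. i \<in> {..<m} \<Longrightarrow> A i \<in> sets lborel"
    have A': "(+) (c i) -` A i \<in> sets lborel" if "i < m" for i
      using A[of i] that by (auto intro!: measurable_sets[of "(+) (c i)" borel borel, simplified])
    have "emeasure ?D (PiE {..<m} A) =
        emeasure (euc m) ((\<lambda>u. \<lambda>x\<in>{..<m}. c x + u x) -` PiE {..<m} A \<inter> space (euc m))"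
      using A by (intro emeasure_distr meas) (auto simp: euc_def intro!: sets_PiM_I_finite)
    also have "(\<lambda>u. \<lambda>x\<in>{..<m}. c x + u x) -` PiE {..<m} A \<inter> space (euc m) =
        PiE {..<m} (\<lambda>i. (+) (c i) -` A i)"
      by (auto simp: space_euc PiE_def Pi_iff)
    also have "emeasure (euc m) \<dots> = (\<Prod>i<m. emeasure lborel ((+) (c i) -` A i))"
      using A' unfolding euc_def by (subst lborel_prod.emeasure_PiM) auto
    also have "\<dots> = (\<Prod>i<m. emeasure lborel (A i))"
    proof (intro prod.cong refl)
      fix i assume "i \<in> {..<m}"
      then have "emeasure (distr lborel borel ((+) (c i))) (A i) = emeasure lborel ((+) (c i) -` A i)"
        using A by (subst emeasure_distr) auto
      then show "emeasure lborel ((+) (c i) -` A i) = emeasure lborel (A i)"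
        by (simp add: lborel_distr_plus)
    qed
    finally show "emeasure ?D (PiE {..<m} A) = (\<Prod>i<m. emeasure lborel (A i))" .
  qed (auto simp: euc_def)
  then show ?thesis by (simp add: euc_def)
qed

text \<open>As \<open>Suc k = 2 ^ m\<close>, the numbers below \<open>Suc k\<close> name the
  corners: bit \<open>x\<close> of the number is the sign of coordinate \<open>x\<close>. The bound
  on \<open>\<epsilon>\<close> keeps noisy corners apart and inside the cube.\<close>

locale hard_instance =
  fixes m k :: nat and \<epsilon> :: real
  assumes m: "m \<ge> 1" and k: "Suc k = 2 ^ m" and \<epsilon>: "0 < \<epsilon>" "\<epsilon> \<le> 1 / 2"
begin

lemma k_ge_1: "k \<ge> 1"
proof -
  have "(2::nat) ^ 1 \<le> 2 ^ m" using m by (intro power_increasing) auto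
  then show ?thesis using k by simp
qed

section \<open>Noisy corners, and the requests and configurations built from them\<close>

abbreviation X :: setting where "X \<equiv> cube m"
abbreviation d :: "point \<Rightarrow> point \<Rightarrow> real" where "d \<equiv> norm_dist m (linf m)"

text \<open>The noise \<open>u\<close> is almost surely in \<open>[0, \<epsilon>]\<^sup>m\<close>; clamping it saves all null sets.\<close>

definition spot :: "nat \<Rightarrow> point \<Rightarrow> point" where
  "spot i u = (\<lambda>x\<in>{..<m}. (if bit i x then 1 else -1) + max 0 (min \<epsilon> (u x)))"

lemma spot_in_pts: "spot i u \<in> pts X"
  using \<epsilon> unfolding pts_cube[OF m] by (auto simp: spot_def)

lemma dist_spot_le: "d (spot i u) (spot j v) \<le> \<epsilon> + 3 * of_bool (i \<noteq> j)"
  using \<epsilon> by (subst norm_dist_linf_le_iff[OF m]) (auto simp: spot_def)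

text \<open>Two numbers below \<open>2 ^ m\<close> differ in a bit \<open>x < m\<close>; one such
  coordinate suffices in the maximum norm, where the corners differ by 2 and the noise takes away at
  most \<open>\<epsilon> \<le> 1 / 2\<close>.\<close>

lemma dist_spot_ge:
  assumes "i < Suc k" "j < Suc k" "i \<noteq> j"
  shows "d (spot i u) (spot j v) \<ge> 3 / 2"
proof -
  have "take_bit m i = i" "take_bit m j = j" using assms k by (auto simp: take_bit_nat_eq_self)
  then obtain x where "x < m" "bit i x \<noteq> bit j x"
    using assms(3) by (metis bit_eqI bit_take_bit_iff)
  then have "3 / 2 \<le> \<bar>spot i u x - spot j v x\<bar>" using \<epsilon> by (auto simp: spot_def)
  also have "\<dots> \<le> d (spot i u) (spot j v)" using \<open>x < m\<close> by (rule coord_le_norm_dist_linf)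
  finally show ?thesis .
qed

text \<open>The noise is quantified, so that whether a server is far from a spot is settled before
  the noise of the next request is drawn. A point within 1/2 of two spots would bring them below
  distance 1.\<close>

definition close :: "point \<Rightarrow> nat \<Rightarrow> bool" where
  "close x i \<longleftrightarrow> (\<exists>u. d x (spot i u) < 1 / 2)"

lemma close_unique: "close x i \<Longrightarrow> close x j \<Longrightarrow> i < Suc k \<Longrightarrow> j < Suc k \<Longrightarrow> i = j"
proof (rule ccontr)
  assume "close x i" "close x j" "i < Suc k" "j < Suc k" "i \<noteq> j"
  then obtain u v where "d x (spot i u) < 1 / 2" "d x (spot j v) < 1 / 2"
    unfolding close_def by blast
  then show False
    using dist_spot_ge[of i j u v] norm_dist_linf_triangle[OF m, of "spot i u" "spot j v" x]
      norm_dist_linf_commute[of m x "spot i u"] \<open>i < Suc k\<close> \<open>j < Suc k\<close> \<open>i \<noteq> j\<close> by linarith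
qed

text \<open>Server \<open>l\<close> lives at spot \<open>l\<close>, and spot \<open>k\<close> is
  taken by the server whose home is the hole \<open>h\<close>. Moving the hole thus involves at most
  two of the labelled servers.\<close>

definition place :: "nat \<Rightarrow> nat list" where
  "place h = map (\<lambda>l. if l = h then k else l) [0..<k]"

lemma length_place [simp]: "length (place h) = k"
  by (simp add: place_def)

lemma nth_place: "l < k \<Longrightarrow> place h ! l = (if l = h then k else l)"
  by (simp add: place_def)

lemma set_place:
  assumes "h < Suc k"
  shows "set (place h) = {..<Suc k} - {h}"
  using assms by (auto simp: place_def image_iff Bex_def)

text \<open>Chasing small sets is dual to the two other problems: the single server is where a
  configuration of \<open>k\<close> servers has its hole, and the request \<open>j\<close> consists of all spots but \<open>j\<close>.\<close>

fun request_spots :: "problem \<Rightarrow> nat \<Rightarrow> nat list" where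
  "request_spots K_Server j = [j]"
| "request_spots K_Taxi j = [j, j]"
| "request_spots Chasing j = place j"

fun config_spots :: "problem \<Rightarrow> nat \<Rightarrow> nat list" where
  "config_spots K_Server h = place h"
| "config_spots K_Taxi h = place h"
| "config_spots Chasing h = [h]"

text \<open>All points of a request share one noise vector; smoothness constrains only the
  marginals. In particular the free trip of a taxi request has length 0.\<close>

definition req :: "problem \<Rightarrow> nat \<Rightarrow> point \<Rightarrow> request" where
  "req P j u = map (\<lambda>i. spot i u) (request_spots P j)"

text \<open>All servers are shifted by the same noise vector, that of the request just served, so
  that the requested points are hit exactly.\<close>

definition conf :: "problem \<Rightarrow> nat \<Rightarrow> point \<Rightarrow> config" where
  "conf P h u = map (\<lambda>i. spot i u) (config_spots P h)"

definition req_len :: "problem \<Rightarrow> nat" where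
  "req_len P = length (request_spots P 0)"

lemma length_request_spots: "length (request_spots P j) = req_len P"
  by (cases P) (simp_all add: req_len_def)

lemma length_req [simp]: "length (req P j u) = req_len P"
  by (simp add: req_def length_request_spots)

lemma req_len: "req_len P \<in> request_lengths P k" "req_len P > 0"
  using k_ge_1 by (cases P; simp add: req_len_def)+

lemma conf_in_configs: "conf P h u \<in> configs P k X"
  using spot_in_pts by (cases P) (auto simp: configs_def conf_def)

section \<open>Costs of a single request and of an offline schedule\<close>

lemma sum_dist_conf_le:
  assumes "h < Suc k" "h' < Suc k"
  shows "(\<Sum>l<k. ennreal (d (spot (place h ! l) u) (spot (place h' ! l) v)))
    \<le> ennreal (k * \<epsilon> + 6 * of_bool (h \<noteq> h'))"
proof -
  \<comment> \<open>Every server pays at most \<open>\<epsilon>\<close> to follow the noise; only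
    the servers \<open>h\<close> and \<open>h'\<close> may also change spots, for at most 3
    each.\<close>
  have "(\<Sum>l<k. ennreal (d (spot (place h ! l) u) (spot (place h' ! l) v)))
      \<le> (\<Sum>l<k. ennreal (\<epsilon> + 3 * of_bool (h \<noteq> h') * (of_bool (l = h) + of_bool (l = h'))))"
  proof (intro sum_mono ennreal_leI)
    fix l assume "l \<in> {..<k}"
    then show "d (spot (place h ! l) u) (spot (place h' ! l) v)
        \<le> \<epsilon> + 3 * of_bool (h \<noteq> h') * (of_bool (l = h) + of_bool (l = h'))"
      by (intro order_trans[OF dist_spot_le]) (auto simp: nth_place)
  qed
  also have "\<dots> = ennreal (\<Sum>l<k. \<epsilon> + 3 * of_bool (h \<noteq> h') * (of_bool (l = h) + of_bool (l = h')))"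
    using \<epsilon> by (intro sum_ennreal) auto
  also have "\<dots> \<le> ennreal (k * \<epsilon> + 6 * of_bool (h \<noteq> h'))"
  proof (rule ennreal_leI)
    have "(\<Sum>l<k. of_bool (l = h) + of_bool (l = h')) \<le> (2::real)" for h'
      by (simp add: sum.distrib of_bool_def)
    then have "3 * of_bool (h \<noteq> h') * (\<Sum>l<k. of_bool (l = h) + of_bool (l = h'))
        \<le> 3 * of_bool (h \<noteq> h') * (2::real)"
      by (intro mult_left_mono) auto
    then show "(\<Sum>l<k. \<epsilon> + 3 * of_bool (h \<noteq> h') * (of_bool (l = h) + of_bool (l = h')))
        \<le> k * \<epsilon> + 6 * of_bool (h \<noteq> h')"
      by (subst sum.distrib, subst sum_distrib_left[symmetric]) simp
  qed
  finally show ?thesis .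
qed

lemma step_cost_conf_le:
  assumes "h < Suc k" "h' < Suc k" "j < Suc k" "h' \<noteq> j"
  shows "step_cost P k X (conf P h u) (req P j v) (conf P h' v)
    \<le> ennreal (k * \<epsilon> + 6 * of_bool (h \<noteq> h'))"
proof -
  have "j \<in> set (place h')" using assms by (simp add: set_place)
  then obtain i where i: "i < k" "place h' ! i = j" by (auto simp: in_set_conv_nth)
  show ?thesis
  proof (cases P)
    case K_Server
    have "spot j v \<in> set (conf K_Server h' v)"
      using \<open>j \<in> set (place h')\<close> by (auto simp: conf_def)
    then show ?thesis
      using K_Server conf_in_configs[of K_Server h' v] sum_dist_conf_le[OF assms(1,2), of u v]
      by (cases "h = h'"; simp add: step_cost_def req_def) (simp_all add: conf_def)
  next
    case K_Taxi
    let ?f = "\<lambda>l. ennreal (d (spot (place h ! l) u) (spot (place h' ! l) v))"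
    \<comment> \<open>Taxi \<open>i\<close>, which ends at spot \<open>j\<close>, serves the
      request. Pickup and destination coincide, so its paid trip is its whole displacement and the
      total is the one of \<open>k\<close> servers.\<close>
    have "serve_cost K_Taxi X (conf K_Taxi h u) (req K_Taxi j v) (conf K_Taxi h' v)
        \<le> ?f i + (\<Sum>l\<in>{..<k} - {i}. ?f l)"
      unfolding serve_cost.simps using i
      by (intro INF_lower2[of i]) (simp_all add: conf_def req_def)
    also have "\<dots> = (\<Sum>l<k. ?f l)" using i by (subst sum.remove[of _ i]) auto
    also note sum_dist_conf_le[OF assms(1,2)]
    finally show ?thesis using K_Taxi conf_in_configs[of K_Taxi h' v] by (simp add: step_cost_def)
  next
    case Chasing
    have "d (spot h u) (spot h' v) \<le> \<epsilon> + 3 * of_bool (h \<noteq> h')" by (rule dist_spot_le)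
    also have "\<dots> \<le> k * \<epsilon> + 6 * of_bool (h \<noteq> h')"
    proof -
      have "\<epsilon> \<le> k * \<epsilon>" using \<epsilon> k_ge_1 by simp
      then show ?thesis by auto
    qed
    finally have "ennreal (d (spot h u) (spot h' v)) \<le> ennreal (k * \<epsilon> + 6 * of_bool (h \<noteq> h'))"
      by (rule ennreal_leI)
    moreover have "h' \<in> set (place j)" using assms by (simp add: set_place)
    ultimately show ?thesis
      using Chasing conf_in_configs[of Chasing h' v]
      by (simp add: step_cost_def conf_def req_def)
  qed
qed

text \<open>Pigeonhole: otherwise \<open>k + 1\<close> spots would each have a close server, and by
  \<open>close_unique\<close> no server is close to two of them.\<close>

lemma uncovered_spot:
  assumes "length s = k"
  obtains j where "j < Suc k" "\<And>l. l < k \<Longrightarrow> \<not> close (s ! l) j"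
proof (rule ccontr)
  assume "\<not> thesis"
  then have "\<forall>j\<in>{..<Suc k}. \<exists>l<k. close (s ! l) j" using that by blast
  then obtain f where f: "\<And>j. j < Suc k \<Longrightarrow> f j < k \<and> close (s ! f j) j" by (metis lessThan_iff)
  then have "inj_on f {..<Suc k}" by (intro inj_onI) (metis close_unique lessThan_iff)
  moreover have "f ` {..<Suc k} \<subseteq> {..<k}" using f by auto
  ultimately show False using card_inj_on_le[of f "{..<Suc k}" "{..<k}"] by simp
qed

text \<open>The order of quantifiers matters: \<open>j\<close> depends only on the current
  configuration, so an independent uniform request hits it with probability
  \<open>1 / (k + 1)\<close>, whatever its noise and the reaction to it.\<close>

lemma expensive_request:
  assumes "s \<in> configs P k X"
  shows "\<exists>j<Suc k. \<forall>u s'. ennreal (1 / 2) \<le> step_cost P k X s (req P j u) s'"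
proof (cases P)
  case K_Server
  then have len: "length s = k" using assms by (simp add: configs_def)
  then obtain j where j: "j < Suc k" "\<And>l. l < k \<Longrightarrow> \<not> close (s ! l) j" using uncovered_spot by blast
  have "ennreal (1 / 2) \<le> step_cost P k X s (req P j u) s'" for u s'
  proof (cases "s' \<in> configs P k X \<and> spot j u \<in> set s'")
    case True
    then obtain l where l: "l < k" "s' ! l = spot j u"
      using K_Server by (auto simp: configs_def in_set_conv_nth)
    have "ennreal (1 / 2) \<le> ennreal (d (s ! l) (s' ! l))"
      using j(2)[OF l(1)] by (intro ennreal_leI) (auto simp: close_def l not_less)
    also have "\<dots> \<le> (\<Sum>l<k. ennreal (d (s ! l) (s' ! l)))"
      using l(1) by (intro member_le_sum) auto
    finally show ?thesis using True K_Server by (simp add: step_cost_def req_def len)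
  qed (use K_Server in \<open>auto simp: step_cost_def req_def\<close>)
  then show ?thesis using j(1) by blast
next
  case K_Taxi
  then have len: "length s = k" using assms by (simp add: configs_def)
  then obtain j where j: "j < Suc k" "\<And>l. l < k \<Longrightarrow> \<not> close (s ! l) j" using uncovered_spot by blast
  have "ennreal (1 / 2) \<le> step_cost P k X s (req P j u) s'" for u s'
  proof (cases "s' \<in> configs P k X")
    case True
    have "ennreal (1 / 2) \<le> serve_cost K_Taxi X s (req K_Taxi j u) s'"
      unfolding serve_cost.simps
    proof (rule INF_greatest)
      fix l assume "l \<in> {i. i < length s \<and> s' ! i = req K_Taxi j u ! 1}"
      then have "ennreal (1 / 2) \<le> ennreal (d (s ! l) (spot j u))"
        using j(2)[of l] by (intro ennreal_leI) (auto simp: close_def len not_less)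
      then show "ennreal (1 / 2) \<le> ennreal (sdist X (s ! l) (req K_Taxi j u ! 0)) +
          (\<Sum>j\<in>{..<length s} - {l}. ennreal (sdist X (s ! j) (s' ! j)))"
        by (simp add: req_def add_increasing2)
    qed
    then show ?thesis using True K_Taxi by (simp add: step_cost_def)
  qed (auto simp: step_cost_def)
  then show ?thesis using j(1) by blast
next
  case Chasing
  \<comment> \<open>The server is close to at most one spot. The request \<open>j\<close> omits just
    that spot, so every point it offers is far away; if no spot is close, any \<open>j\<close> will
    do.\<close>
  obtain j where j: "j < Suc k" "\<And>i. i < Suc k \<Longrightarrow> close (s ! 0) i \<Longrightarrow> i = j"
    using close_unique by (metis zero_less_Suc)
  have "ennreal (1 / 2) \<le> step_cost P k X s (req P j u) s'" for u s'
  proof (cases "s' \<in> configs P k X \<and> s' ! 0 \<in> set (req P j u)")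
    case True
    then obtain i where i: "i < Suc k" "i \<noteq> j" "s' ! 0 = spot i u"
      using Chasing j(1) by (auto simp: req_def set_place)
    then have "\<not> d (s ! 0) (s' ! 0) < 1 / 2" using j(2)[of i] unfolding close_def by metis
    then have "ennreal (1 / 2) \<le> ennreal (d (s ! 0) (s' ! 0))" by (intro ennreal_leI) simp
    then show ?thesis using True Chasing by (simp add: step_cost_def)
  qed (use Chasing in \<open>auto simp: step_cost_def\<close>)
  then show ?thesis using j(1) by blast
qed

text \<open>The offline player translates an optimal path of the hole into configurations; each move
  of the hole costs at most 6, and following the noise at most \<open>k * \<epsilon>\<close> per
  request.\<close>

lemma opt_cost_le:
  assumes js: "length js = T" "set js \<subseteq> {..<Suc k}"
    and r: "\<And>t. t < T \<Longrightarrow> r t = req P (js ! t) (u t)"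
  shows "opt_cost P k X (conf P 0 (\<lambda>_. 0)) T r
    \<le> ennreal (6 * real (hole_cost (Suc k) js) + real T * (real k * \<epsilon>))"
proof -
  obtain hs where hs: "list_all2 (\<noteq>) hs js" "set hs \<subseteq> {..<Suc k}"
      "moves 0 hs \<le> hole_cost (Suc k) js"
    using avoidable_hole_cost[of "Suc k" js] k_ge_1 by (auto simp: avoidable_def)
  have len: "length hs = T" using hs(1) js(1) by (simp add: list_all2_lengthD)
  \<comment> \<open>\<open>hs ! t\<close> is the hole after request \<open>t\<close>, which is
    configuration \<open>Suc t\<close>; hence the shifted list \<open>0 # hs\<close> and the noise
    \<open>u (t - 1)\<close>.\<close>
  define s where "s t = conf P ((0 # hs) ! t) (if t = 0 then \<lambda>_. 0 else u (t - 1))" for t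
  have "opt_cost P k X (conf P 0 (\<lambda>_. 0)) T r \<le> path_cost P k X T r s"
    unfolding opt_cost_def by (rule INF_lower) (simp add: s_def)
  also have "\<dots> \<le> (\<Sum>t<T. ennreal (k * \<epsilon> + 6 * of_bool ((0 # hs) ! t \<noteq> hs ! t)))"
    unfolding path_cost_def
  proof (rule sum_mono)
    fix t assume "t \<in> {..<T}"
    then have t: "t < T" by simp
    then have "hs ! t < Suc k" "js ! t < Suc k" "hs ! t \<noteq> js ! t"
      using hs(2) js len list_all2_nthD[OF hs(1), of t] nth_mem[of t hs] nth_mem[of t js]
      by (auto simp del: nth_mem)
    moreover have "(0 # hs) ! t < Suc k"
    proof -
      have "(0 # hs) ! t \<in> set (0 # hs)" using t len by (intro nth_mem) simp
      then show ?thesis using hs(2) by auto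
    qed
    ultimately show "step_cost P k X (s t) (r t) (s (Suc t))
        \<le> ennreal (k * \<epsilon> + 6 * of_bool ((0 # hs) ! t \<noteq> hs ! t))"
      using step_cost_conf_le[of "(0 # hs) ! t" "hs ! t" "js ! t"] r[OF t] by (simp add: s_def)
  qed
  also have "\<dots> = ennreal (\<Sum>t<T. k * \<epsilon> + 6 * of_bool ((0 # hs) ! t \<noteq> hs ! t))"
    using \<epsilon> by (intro sum_ennreal) auto
  also have "(\<Sum>t<T. k * \<epsilon> + 6 * of_bool ((0 # hs) ! t \<noteq> hs ! t)) = T * (k * \<epsilon>) + 6 * moves 0 hs"
    by (simp add: moves_conv_sum len sum.distrib sum_distrib_left)
  also have "ennreal \<dots> \<le> ennreal (6 * real (hole_cost (Suc k) js) + real T * (real k * \<epsilon>))"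
    using hs(3) by (intro ennreal_leI) simp
  finally show ?thesis .
qed

end

text \<open>The integral of an arbitrary function is a lower integral: only measurable minorants
  have to be estimated.\<close>

lemma nn_integral_le_if_minorants_le:
  assumes "\<And>g. g \<in> borel_measurable M \<Longrightarrow> g \<le> f \<Longrightarrow> (\<integral>\<^sup>+x. g x \<partial>M) \<le> b"
  shows "(\<integral>\<^sup>+x. f x \<partial>M) \<le> b"
  unfolding nn_integral_def[of M f]
proof (rule SUP_least)
  fix g assume "g \<in> {g. simple_function M g \<and> g \<le> f}"
  then show "integral\<^sup>S M g \<le> b"
    using assms[of g] by (simp add: nn_integral_eq_simple_integral borel_measurable_simple_function)
qed

section \<open>The request distribution and its smoothness\<close>

context hard_instance
begin

abbreviation R :: "problem \<Rightarrow> request measure" where "R P \<equiv> request_space P k X"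

definition noise :: "point measure" where
  "noise = uniform_measure (euc m) (PiE {..<m} (\<lambda>_. {0..\<epsilon>}))"

definition request_dist :: "problem \<Rightarrow> request measure" where
  "request_dist P =
     distr (measure_pmf (pmf_of_set {..<Suc k}) \<Otimes>\<^sub>M noise) (R P) (\<lambda>(j, u). req P j u)"

lemma emeasure_noise_box: "emeasure (euc m) (PiE {..<m} (\<lambda>_. {0..\<epsilon>})) = ennreal (\<epsilon> ^ m)"
  using \<epsilon> by (subst emeasure_euc_box) auto

lemma prob_space_noise: "prob_space noise"
  unfolding noise_def using \<epsilon> by (intro prob_space_uniform_measure) (auto simp: emeasure_noise_box)

sublocale noise: prob_space noise by (rule prob_space_noise)

sublocale request_pair: pair_prob_space "measure_pmf (pmf_of_set {..<Suc k})" noise ..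

lemma sets_noise [measurable_cong]: "sets noise = sets (euc m)"
  by (simp add: noise_def)

lemma space_noise: "space noise = extensional {..<m}"
  by (simp add: noise_def space_euc)

lemma spot_measurable [measurable]: "spot i \<in> measurable (euc m) (euc m)"
  unfolding spot_def euc_def by measurable

lemma space_R: "space (R P) = {r. length r \<in> request_lengths P k \<and> set r \<subseteq> pts X}"
  by (simp add: request_space_def Let_def space_measure_of_conv)

lemma req_in_space: "req P j u \<in> space (R P)"
  using spot_in_pts req_len(1) by (auto simp: space_R) (auto simp: req_def)

lemma R_generator:
  assumes "i < n" "S \<in> sets (euc m)" "S \<subseteq> pts X"
  shows "{r \<in> space (R P). length r = n \<and> r ! i \<in> S} \<in> sets (R P)"
  unfolding space_R unfolding request_space_def Let_def
  using assms by (subst sets_measure_of) (auto intro!: sigma_sets.Basic)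

lemma req_measurable: "req P j \<in> measurable (euc m) (R P)"
proof -
  let ?\<Omega> = "{r. length r \<in> request_lengths P k \<and> set r \<subseteq> pts X}"
  show ?thesis
    unfolding request_space_def Let_def
  proof (rule measurable_measure_of)
    show "req P j \<in> space (euc m) \<rightarrow> ?\<Omega>"
      using req_in_space unfolding space_R by blast
    fix A assume "A \<in> {{r \<in> ?\<Omega>. length r = n \<and> r ! i \<in> S} |n i S.
        i < n \<and> S \<in> sets (euc (dim X)) \<and> S \<subseteq> pts X}"
    then obtain n i S where A: "A = {r \<in> ?\<Omega>. length r = n \<and> r ! i \<in> S}" "i < n"
        "S \<in> sets (euc m)" by auto
    have "req P j -` A \<inter> space (euc m) =
        (if req_len P = n then spot (request_spots P j ! i) -` S \<inter> space (euc m) else {})"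
      using A(2) req_in_space[of P j, unfolded space_R]
      by (auto simp: A(1)) (simp_all add: req_def length_request_spots)
    then show "req P j -` A \<inter> space (euc m) \<in> sets (euc m)"
      using measurable_sets[OF spot_measurable A(3)] by simp
  qed auto
qed

lemma req_pair_measurable [measurable]:
  "(\<lambda>(j, u). req P j u) \<in> measurable (measure_pmf (pmf_of_set {..<Suc k}) \<Otimes>\<^sub>M noise) (R P)"
proof -
  have "(\<lambda>(j, u). req P j u) \<in> measurable (count_space UNIV \<Otimes>\<^sub>M euc m) (R P)"
    by (rule measurable_pair_measure_countable1) (auto simp: req_measurable)
  then show ?thesis
    by (simp cong: measurable_cong_sets sets_pair_measure_cong add: sets_noise)
qed

lemma prob_space_request_dist: "prob_space (request_dist P)"
  unfolding request_dist_def by (rule request_pair.prob_space_distr) measurable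

lemma sets_request_dist [measurable_cong, simp]: "sets (request_dist P) = sets (R P)"
  by (simp add: request_dist_def)

lemma space_request_dist [simp]: "space (request_dist P) = space (R P)"
  by (simp add: request_dist_def)

lemma nn_integral_request_dist:
  assumes "f \<in> borel_measurable (R P)"
  shows "(\<integral>\<^sup>+r. f r \<partial>request_dist P) =
    (\<integral>\<^sup>+j. (\<integral>\<^sup>+u. f (req P j u) \<partial>noise) \<partial>pmf_of_set {..<Suc k})"
proof -
  have "(\<integral>\<^sup>+r. f r \<partial>request_dist P) = (\<integral>\<^sup>+x. f (case x of (j, u) \<Rightarrow> req P j u)
      \<partial>(measure_pmf (pmf_of_set {..<Suc k}) \<Otimes>\<^sub>M noise))"
    unfolding request_dist_def using assms by (intro nn_integral_distr) simp_all
  also have "\<dots> = (\<integral>\<^sup>+j. (\<integral>\<^sup>+u. f (req P j u) \<partial>noise) \<partial>pmf_of_set {..<Suc k})"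
    using measurable_compose[OF req_pair_measurable assms]
    by (subst noise.nn_integral_fst[symmetric]) simp_all
  finally show ?thesis .
qed

text \<open>On the support of the noise, \<open>spot i\<close> is a translation, so a noisy corner
  has density at most \<open>1 / \<epsilon> ^ m\<close> with respect to the volume.\<close>

lemma emeasure_spot_le:
  assumes "S \<in> sets (euc m)"
  shows "emeasure noise (spot i -` S \<inter> space (euc m)) \<le> emeasure (euc m) S / ennreal (\<epsilon> ^ m)"
proof -
  let ?box = "PiE {..<m} (\<lambda>_. {0..\<epsilon>})" and ?c = "\<lambda>x. if bit i x then 1 else - 1 :: real"
  let ?tr = "\<lambda>u. \<lambda>x\<in>{..<m}. ?c x + u x"
  have tr: "?tr \<in> measurable (euc m) (euc m)" unfolding euc_def by measurable
  have eq: "spot i u = ?tr u" if "u \<in> ?box" for u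
  proof -
    have "u x \<in> {0..\<epsilon>}" if "x < m" for x using PiE_mem[OF \<open>u \<in> ?box\<close>] that by blast
    then show ?thesis by (auto simp: spot_def restrict_def fun_eq_iff)
  qed
  have "emeasure (euc m) (?box \<inter> (spot i -` S \<inter> space (euc m)))
      \<le> emeasure (euc m) (?tr -` S \<inter> space (euc m))"
    using eq measurable_sets[OF tr assms] by (intro emeasure_mono) auto
  also have "\<dots> = emeasure (distr (euc m) (euc m) ?tr) S"
    by (rule emeasure_distr[symmetric, OF tr assms])
  also have "\<dots> = emeasure (euc m) S" by (simp only: distr_euc_translate)
  finally show ?thesis
    using box_in_sets_euc[of m "\<lambda>_. 0" "\<lambda>_. \<epsilon>"] measurable_sets[OF spot_measurable assms]
    unfolding noise_def by (simp add: emeasure_noise_box divide_right_mono_ennreal)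
qed

text \<open>The parameter is the share of the noise box in the cube, \<open>\<epsilon> ^ m\<close>
  out of \<open>4 ^ m\<close>. Each marginal is a mixture over \<open>j\<close> of noisy corners,
  and mixing preserves the bound on the density.\<close>

lemma smooth_request_dist: "smooth_distribution P k ((\<epsilon> / 4) ^ m) X (request_dist P)"
  unfolding smooth_distribution_def
proof (intro bexI conjI allI impI ballI)
  let ?n = "req_len P"
  interpret prob_space "request_dist P" by (rule prob_space_request_dist)
  have gen: "{r \<in> space (R P). length r = ?n \<and> r ! i \<in> S} \<in> sets (R P)"
    if "i < ?n" "S \<in> sets (euc m)" "S \<subseteq> pts X" for i S
    by (rule R_generator[OF that])
  have pts: "pts X \<in> sets (euc m)"
    using metric_setting_cube[OF m] by (simp add: metric_setting_def)
  \<comment> \<open>The vacuous condition on \<open>r ! 0\<close> turns the event into a generator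
    of the sigma-algebra.\<close>
  have "{r \<in> space (R P). length r = ?n} = {r \<in> space (R P). length r = ?n \<and> r ! 0 \<in> pts X}"
    using req_len(2)[of P] by (auto simp: space_R)
  then have "{r \<in> space (R P). length r = ?n} \<in> sets (R P)"
    using gen[OF req_len(2) pts] by simp
  then show "AE r in request_dist P. length r = ?n"
    unfolding request_dist_def by (subst AE_distr_iff) (auto split: prod.split)
  fix i S assume i: "i < ?n" and S: "S \<in> sets (euc (dim X))" "S \<subseteq> pts X"
  let ?A = "{r \<in> space (R P). length r = ?n \<and> r ! i \<in> S}"
  have A: "?A \<in> sets (R P)" using gen i S by simp
  have "emeasure (request_dist P) ?A =
      (\<integral>\<^sup>+j. (\<integral>\<^sup>+u. indicator ?A (req P j u) \<partial>noise) \<partial>pmf_of_set {..<Suc k})"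
    using A by (subst nn_integral_request_dist[symmetric]) simp_all
  also have "\<dots> \<le> (\<integral>\<^sup>+j. emeasure (euc m) S / ennreal (\<epsilon> ^ m) \<partial>pmf_of_set {..<Suc k})"
  proof (rule nn_integral_mono)
    fix j
    have "(\<integral>\<^sup>+u. indicator ?A (req P j u) \<partial>noise) =
        (\<integral>\<^sup>+u. indicator (spot (request_spots P j ! i) -` S \<inter> space (euc m)) u \<partial>noise)"
      using i req_in_space[of P j]
      by (intro nn_integral_cong) (auto simp: req_def length_request_spots space_noise space_euc
          split: split_indicator)
    also have "\<dots> \<le> emeasure (euc m) S / ennreal (\<epsilon> ^ m)"
      using emeasure_spot_le[of S] measurable_sets[OF spot_measurable, of S] S(1)
      by (simp add: sets_noise)
    finally show "(\<integral>\<^sup>+u. indicator ?A (req P j u) \<partial>noise) \<le> emeasure (euc m) S / ennreal (\<epsilon> ^ m)" .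
  qed
  also have "\<dots> = emeasure (euc m) S / ennreal (\<epsilon> ^ m)" by simp
  also have "emeasure (euc m) S = ennreal (measure (euc m) S)"
  proof -
    have "emeasure (euc m) S \<le> emeasure (euc m) (pts X)" by (rule emeasure_mono[OF S(2) pts])
    also have "\<dots> < \<infinity>" by (simp add: pts_cube[OF m] emeasure_euc_box)
    finally show ?thesis by (simp add: emeasure_eq_ennreal_measure less_top)
  qed
  also have "ennreal (measure (euc m) S) / ennreal (\<epsilon> ^ m) = ennreal (measure (euc m) S / \<epsilon> ^ m)"
    using \<epsilon> by (intro divide_ennreal) auto
  finally have "measure (request_dist P) ?A \<le> measure (euc m) S / \<epsilon> ^ m"
    using \<epsilon> by (simp add: emeasure_eq_measure)
  also have "\<dots> = 1 / (\<epsilon> / 4) ^ m * (measure (euc m) S / 4 ^ m)"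
    by (simp add: power_divide)
  also have "\<dots> \<le> 1 / (\<epsilon> / 4) ^ m * (measure (euc m) S / measure (euc m) (min_ball X))"
    using \<epsilon> min_ball_cube[OF m] by (intro mult_left_mono divide_left_mono mult_pos_pos) auto
  also have "S = S \<inter> min_ball X" using S(2) min_ball_cube(1)[OF m] by auto
  finally show "measure (request_dist P) {r \<in> space (request_dist P). length r = ?n \<and> r ! i \<in> S}
      \<le> 1 / (\<epsilon> / 4) ^ m * (measure (euc (dim X)) (S \<inter> min_ball X) / measure (euc (dim X)) (min_ball X))"
    using \<open>S = S \<inter> min_ball X\<close> by simp
qed (rule req_len)

lemma Ionescu_Tulcea_request_dist: "Ionescu_Tulcea (\<lambda>_ _. request_dist P) (\<lambda>_. R P)"
proof (rule Ionescu_Tulcea.intro)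
  have "subprob_space (request_dist P)"
    by (rule prob_space_imp_subprob_space[OF prob_space_request_dist])
  then show "(\<lambda>_. request_dist P) \<in> measurable (PiM {0..<i} (\<lambda>_. R P)) (subprob_algebra (R P))" for i
    by (intro measurable_const) (simp add: space_subprob_algebra)
qed (rule prob_space_request_dist)

sublocale IT: Ionescu_Tulcea "\<lambda>_ _. request_dist P" "\<lambda>_. R P" for P
  by (rule Ionescu_Tulcea_request_dist)

lemma smooth_adversary_request_dist:
  "smooth_adversary P k ((\<epsilon> / 4) ^ m) X (\<lambda>_ _. request_dist P)"
  unfolding smooth_adversary_def using Ionescu_Tulcea_request_dist smooth_request_dist by blast

section \<open>The law of the request sequence\<close>

abbreviation law :: "problem \<Rightarrow> nat \<Rightarrow> (nat \<Rightarrow> request) measure" where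
  "law P T \<equiv> request_law P k X (\<lambda>_ _. request_dist P) T"

abbreviation histories :: "problem \<Rightarrow> nat \<Rightarrow> (nat \<Rightarrow> request) measure" where
  "histories P T \<equiv> PiM {0..<T} (\<lambda>_. R P)"

lemma sets_law [measurable_cong]: "sets (law P T) = sets (histories P T)"
  unfolding request_law_def by (subst IT.sets_C) (simp_all add: space_PiM)

lemma space_law: "space (law P T) = space (histories P T)"
  by (rule sets_eq_imp_space_eq[OF sets_law])

lemma prob_space_law: "prob_space (law P T)"
  unfolding request_law_def by (rule IT.prob_space_C) (simp add: space_PiM)

lemma borel_measurable_law: "borel_measurable (law P T) = borel_measurable (histories P T)"
  by (rule measurable_cong_sets[OF sets_law refl])

lemma nn_integral_law_0:
  assumes "f \<in> borel_measurable (histories P 0)"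
  shows "(\<integral>\<^sup>+r. f r \<partial>law P 0) = f (\<lambda>_. undefined)"
  unfolding request_law_def using assms
  by (subst IT.C.simps) (subst nn_integral_return; simp add: space_PiM)

lemma nn_integral_law_Suc:
  assumes "f \<in> borel_measurable (histories P (Suc T))"
  shows "(\<integral>\<^sup>+r. f r \<partial>law P (Suc T)) = (\<integral>\<^sup>+h. (\<integral>\<^sup>+x. f (h(T := x)) \<partial>request_dist P) \<partial>law P T)"
proof -
  have "(\<integral>\<^sup>+r. f r \<partial>law P (Suc T)) = (\<integral>\<^sup>+h. (\<integral>\<^sup>+r. f r \<partial>IT.eP P T h) \<partial>law P T)"
    unfolding request_law_def IT.C.simps
    using assms IT.measurable_C[of P 0 T] IT.measurable_eP[of P T]
    by (subst nn_integral_bind[where B = "histories P (Suc T)"])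
       (simp_all add: space_PiM measurable_cong_sets[OF IT.sets_C refl])
  also have "\<dots> = (\<integral>\<^sup>+h. (\<integral>\<^sup>+x. f (h(T := x)) \<partial>request_dist P) \<partial>law P T)"
    using assms by (intro nn_integral_cong IT.nn_integral_eP) (simp_all add: space_law)
  finally show ?thesis .
qed

lemma fun_upd_measurable:
  "h \<in> space (histories P T) \<Longrightarrow> (\<lambda>x. h(T := x)) \<in> measurable (R P) (histories P (Suc T))"
  by (rule measurable_fun_upd[where J = "{0..<T}"]) auto

lemma fun_upd_in_space:
  "h \<in> space (histories P T) \<Longrightarrow> x \<in> space (R P) \<Longrightarrow> h(T := x) \<in> space (histories P (Suc T))"
  using measurable_space[OF fun_upd_measurable] by blast

text \<open>Requests are integrated out from the last one backwards: \<open>f\<close> and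
  \<open>g\<close> are replaced by their averages \<open>f'\<close> and \<open>g'\<close> over the
  last request, to which the induction hypothesis applies. The noise drops out because
  \<open>g\<close> sees only the corners.\<close>

lemma nn_integral_law_le_coupons_measurable:
  assumes "f \<in> borel_measurable (histories P T)"
    and "\<And>r js u. \<lbrakk>r \<in> space (histories P T); length js = T; set js \<subseteq> {..<Suc k};
      \<And>t. t < T \<Longrightarrow> r t = req P (js ! t) (u t)\<rbrakk> \<Longrightarrow> f r \<le> g js"
  shows "(\<integral>\<^sup>+r. f r \<partial>law P T) \<le> (\<integral>\<^sup>+js. g js \<partial>coupons (Suc k) T)"
  using assms
proof (induction T arbitrary: f g)
  case 0
  have "f (\<lambda>_. undefined) \<le> g []" by (rule 0(2)) (simp_all add: space_PiM)
  then show ?case by (simp add: nn_integral_law_0[OF 0(1)] nn_integral_return)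
next
  case (Suc T)
  define f' where "f' h = (\<integral>\<^sup>+x. f (h(T := x)) \<partial>request_dist P)" for h
  define g' where "g' js = (\<integral>\<^sup>+j. g (js @ [j]) \<partial>pmf_of_set {..<Suc k})" for js
  interpret D: prob_space "request_dist P" by (rule prob_space_request_dist)
  have "snd \<in> measurable (histories P T \<Otimes>\<^sub>M request_dist P) (R P)"
    unfolding measurable_cong_sets[OF refl sets_request_dist, symmetric] by (rule measurable_snd)
  then have "(\<lambda>(h, x). h(T := x)) \<in> measurable (histories P T \<Otimes>\<^sub>M request_dist P) (histories P (Suc T))"
    unfolding split_beta' by (intro measurable_fun_upd[where J = "{0..<T}"]) auto
  then have "(\<lambda>(h, x). f (h(T := x))) \<in> borel_measurable (histories P T \<Otimes>\<^sub>M request_dist P)"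
    using measurable_compose[OF _ Suc(2)] by (simp add: split_beta')
  then have "f' \<in> borel_measurable (histories P T)"
    unfolding f'_def by (intro D.borel_measurable_nn_integral) (simp add: split_beta')
  moreover have "f' h \<le> g' js"
    if h: "h \<in> space (histories P T)" and js: "length js = T" "set js \<subseteq> {..<Suc k}"
      and eq: "\<And>t. t < T \<Longrightarrow> h t = req P (js ! t) (u t)" for h js u
  proof -
    have "f' h = (\<integral>\<^sup>+j. (\<integral>\<^sup>+v. f (h(T := req P j v)) \<partial>noise) \<partial>pmf_of_set {..<Suc k})"
      unfolding f'_def
      by (rule nn_integral_request_dist[OF measurable_compose[OF fun_upd_measurable[OF h] Suc(2)]])
    also have "\<dots> \<le> (\<integral>\<^sup>+j. (\<integral>\<^sup>+v. g (js @ [j]) \<partial>noise) \<partial>pmf_of_set {..<Suc k})"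
    proof (intro nn_integral_mono_AE AE_pmfI AE_I2)
      fix j v assume "j \<in> set_pmf (pmf_of_set {..<Suc k})"
      then have "j < Suc k" by (simp add: lessThan_empty_iff)
      show "f (h(T := req P j v)) \<le> g (js @ [j])"
      proof (rule Suc(3)[of _ "js @ [j]" "u(T := v)"])
        show "h(T := req P j v) \<in> space (histories P (Suc T))"
          by (rule fun_upd_in_space[OF h req_in_space])
      qed (use js eq \<open>j < Suc k\<close> in \<open>auto simp: nth_append less_Suc_eq\<close>)
    qed
    also have "\<dots> = g' js" by (simp add: g'_def noise.emeasure_space_1)
    finally show ?thesis .
  qed
  ultimately have "(\<integral>\<^sup>+h. f' h \<partial>law P T) \<le> (\<integral>\<^sup>+js. g' js \<partial>coupons (Suc k) T)"
    by (rule Suc.IH)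
  \<comment> \<open>\<open>replicate_pmf\<close> recurses at the head of the list, while the last
    request sits at its end; hence the split into \<open>T + 1\<close> draws.\<close>
  also have "\<dots> = (\<integral>\<^sup>+js. g js \<partial>coupons (Suc k) (T + 1))"
    by (simp only: nn_integral_coupons_append replicate_pmf_1 nn_integral_map_pmf g'_def)
  finally show ?case unfolding f'_def nn_integral_law_Suc[OF Suc(2)] by (simp only: Suc_eq_plus1)
qed

text \<open>Intended for \<open>opt_cost\<close>, an infimum over all schedules: each measurable
  minorant inherits the pointwise bound by \<open>g\<close>.\<close>

lemma nn_integral_law_le_coupons:
  assumes "\<And>r js u. \<lbrakk>length js = T; set js \<subseteq> {..<Suc k};
      \<And>t. t < T \<Longrightarrow> r t = req P (js ! t) (u t)\<rbrakk> \<Longrightarrow> f r \<le> g js"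
  shows "(\<integral>\<^sup>+r. f r \<partial>law P T) \<le> (\<integral>\<^sup>+js. g js \<partial>coupons (Suc k) T)"
proof (rule nn_integral_le_if_minorants_le)
  fix \<phi> assume "\<phi> \<in> borel_measurable (law P T)" "\<phi> \<le> f"
  then show "(\<integral>\<^sup>+r. \<phi> r \<partial>law P T) \<le> (\<integral>\<^sup>+js. g js \<partial>coupons (Suc k) T)"
    using assms by (intro nn_integral_law_le_coupons_measurable)
      (auto simp: borel_measurable_law le_fun_def intro: order_trans)
qed

section \<open>Expected offline and online costs\<close>

lemma expected_opt_cost_le:
  "(\<integral>\<^sup>+r. opt_cost P k X (conf P 0 (\<lambda>_. 0)) T r \<partial>law P T)
    \<le> 6 * (\<integral>\<^sup>+js. ennreal (real (hole_cost (Suc k) js)) \<partial>coupons (Suc k) T) + ennreal (real T * (real k * \<epsilon>))"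
proof -
  have "(\<integral>\<^sup>+r. opt_cost P k X (conf P 0 (\<lambda>_. 0)) T r \<partial>law P T)
      \<le> (\<integral>\<^sup>+js. ennreal (6 * real (hole_cost (Suc k) js) + real T * (real k * \<epsilon>)) \<partial>coupons (Suc k) T)"
  proof (rule nn_integral_law_le_coupons)
    fix r js u
    assume "length js = T" "set js \<subseteq> {..<Suc k}" "\<And>t. t < T \<Longrightarrow> r t = req P (js ! t) (u t)"
    then show "opt_cost P k X (conf P 0 (\<lambda>_. 0)) T r
        \<le> ennreal (6 * real (hole_cost (Suc k) js) + real T * (real k * \<epsilon>))"
      by (rule opt_cost_le)
  qed
  also have "\<dots> = (\<integral>\<^sup>+js. 6 * ennreal (real (hole_cost (Suc k) js)) + ennreal (real T * (real k * \<epsilon>)) \<partial>coupons (Suc k) T)"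
    using \<epsilon> by (intro nn_integral_cong) (simp add: ennreal_plus ennreal_mult)
  also have "\<dots> = 6 * (\<integral>\<^sup>+js. ennreal (real (hole_cost (Suc k) js)) \<partial>coupons (Suc k) T) + ennreal (real T * (real k * \<epsilon>))"
    by (simp add: nn_integral_add nn_integral_cmult)
  finally show ?thesis .
qed

text \<open>No measurability of single decisions is needed: the bound on the expected cost of one more
  step is uniform in the history.\<close>

lemma expected_path_cost_ge:
  fixes dec :: "request list \<Rightarrow> config" and s0 :: config
  defines "trail \<equiv> \<lambda>r t. if t = 0 then s0 else dec (map r [0..<t])"
  assumes s0: "s0 \<in> configs P k X"
    and meas: "\<And>T. (\<lambda>r. path_cost P k X T r (trail r)) \<in> borel_measurable (law P T)"
  shows "ennreal (real T / (2 * real (Suc k))) \<le> (\<integral>\<^sup>+r. path_cost P k X T r (trail r) \<partial>law P T)"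
proof (induction T)
  case (Suc T)
  let ?G = "\<lambda>T r. path_cost P k X T r (trail r)"
  interpret law: prob_space "law P T" by (rule prob_space_law)
  have "ennreal (real (Suc T) / (2 * real (Suc k))) = ennreal (real T / (2 * real (Suc k))) + ennreal (1 / (2 * real (Suc k)))"
    by (simp add: ennreal_plus[symmetric] add_divide_distrib del: ennreal_plus)
  also have "\<dots> \<le> (\<integral>\<^sup>+r. ?G T r \<partial>law P T) + ennreal (1 / (2 * real (Suc k)))"
    by (rule add_right_mono[OF Suc])
  also have "\<dots> = (\<integral>\<^sup>+r. ?G T r + ennreal (1 / (2 * real (Suc k))) \<partial>law P T)"
    using meas[of T] by (subst nn_integral_add) (simp_all add: law.emeasure_space_1)
  also have "\<dots> \<le> (\<integral>\<^sup>+h. (\<integral>\<^sup>+x. ?G (Suc T) (h(T := x)) \<partial>request_dist P) \<partial>law P T)"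
  proof (rule nn_integral_mono)
    fix h assume h: "h \<in> space (law P T)"
    have path_upd: "trail (h(T := x)) t = trail h t" if "t \<le> T" for x t
    proof -
      have "map (h(T := x)) [0..<t] = map h [0..<t]" using that by simp
      then show ?thesis by (simp only: trail_def)
    qed
    have G_Suc: "?G (Suc T) (h(T := x)) =
        ?G T h + step_cost P k X (trail h T) x (trail (h(T := x)) (Suc T))" for x
      by (simp add: path_cost_def path_upd)
    \<comment> \<open>Given the history, one corner \<open>j\<close> is bad: every noisy version of
      request \<open>j\<close> raises the cost by at least 1/2, whatever the algorithm does
      next.\<close>
    have "\<exists>j<Suc k. \<forall>x. ?G T h + ennreal (1 / 2) * of_bool (\<exists>u. x = req P j u) \<le> ?G (Suc T) (h(T := x))"
    proof (cases "trail h T \<in> configs P k X")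
      case True
      then obtain j where "j < Suc k"
          "\<And>u s'. ennreal (1 / 2) \<le> step_cost P k X (trail h T) (req P j u) s'"
        using expensive_request by blast
      then show ?thesis unfolding G_Suc by (intro exI[of _ j]) (auto intro!: add_left_mono)
    next
      case False
      \<comment> \<open>An infeasible current configuration cannot be the initial one, so it was
        chosen in an earlier step and the cost is already infinite.\<close>
      then obtain T' where T': "T = Suc T'" using s0 by (cases T) (auto simp: trail_def)
      with False have "?G T h = \<infinity>" by (simp add: path_cost_def step_cost_def)
      then show ?thesis unfolding G_Suc by (intro exI[of _ 0]) simp
    qed
    then obtain j where j: "j < Suc k"
        "\<And>x. ?G T h + ennreal (1 / 2) * of_bool (\<exists>u. x = req P j u) \<le> ?G (Suc T) (h(T := x))"
      by blast
    have "ennreal (1 / (2 * real (Suc k))) = ennreal (1 / 2) * ennreal (1 / real (Suc k))"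
      by (subst ennreal_mult[symmetric]) simp_all
    also have "ennreal (1 / real (Suc k)) = emeasure (pmf_of_set {..<Suc k}) {j}"
      using j(1) by (simp add: emeasure_pmf_single lessThan_empty_iff del: lessThan_Suc)
    also have "ennreal (1 / 2) * emeasure (pmf_of_set {..<Suc k}) {j} =
        (\<integral>\<^sup>+i. ennreal (1 / 2) * indicator {j} i \<partial>pmf_of_set {..<Suc k})"
      by (rule nn_integral_cmult_indicator[symmetric]) simp
    finally have "?G T h + ennreal (1 / (2 * real (Suc k))) =
        (\<integral>\<^sup>+i. ?G T h + ennreal (1 / 2) * indicator {j} i \<partial>pmf_of_set {..<Suc k})"
      by (simp add: nn_integral_add)
    also have "\<dots> = (\<integral>\<^sup>+i. (\<integral>\<^sup>+u. ?G T h + ennreal (1 / 2) * indicator {j} i \<partial>noise) \<partial>pmf_of_set {..<Suc k})"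
      by (simp add: noise.emeasure_space_1)
    also have "\<dots> \<le> (\<integral>\<^sup>+i. (\<integral>\<^sup>+u. ?G (Suc T) (h(T := req P i u)) \<partial>noise) \<partial>pmf_of_set {..<Suc k})"
    proof (intro nn_integral_mono)
      fix i u
      have "?G T h + ennreal (1 / 2) * indicator {j} i
          \<le> ?G T h + ennreal (1 / 2) * of_bool (\<exists>v. req P i u = req P j v)"
        by (intro add_left_mono mult_left_mono) (auto split: split_indicator)
      also note j(2)
      finally show "?G T h + ennreal (1 / 2) * indicator {j} i \<le> ?G (Suc T) (h(T := req P i u))" .
    qed
    also have "\<dots> = (\<integral>\<^sup>+x. ?G (Suc T) (h(T := x)) \<partial>request_dist P)"
      using meas[of "Suc T"] h unfolding borel_measurable_law space_law
      by (intro nn_integral_request_dist[symmetric] measurable_compose[OF fun_upd_measurable]) auto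
    finally show "?G T h + ennreal (1 / (2 * real (Suc k))) \<le> (\<integral>\<^sup>+x. ?G (Suc T) (h(T := x)) \<partial>request_dist P)" .
  qed
  also have "\<dots> = (\<integral>\<^sup>+r. ?G (Suc T) r \<partial>law P (Suc T))"
    using meas[of "Suc T"] unfolding borel_measurable_law by (rule nn_integral_law_Suc[symmetric])
  finally show ?case .
qed simp

text \<open>The easy half of Yao's principle: for each fixed seed the algorithm is deterministic and
  obeys the lower bound, and Tonelli averages over the seeds. One \<open>\<alpha>\<close> serves all
  \<open>T\<close>, so that \<open>T\<close> may grow later.\<close>

lemma competitive_imp_bound:
  fixes A :: "'w algorithm"
  assumes A: "randomized_online_algorithm A"
    and comp: "competitive P k ((\<epsilon> / 4) ^ m) X Q A c"
    and Q: "Q (\<lambda>_ _. request_dist P)"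
  obtains \<alpha> where "\<And>T. ennreal (real T / (2 * real (Suc k))) \<le> ennreal c *
    (6 * (\<integral>\<^sup>+js. ennreal (real (hole_cost (Suc k) js)) \<partial>coupons (Suc k) T) + ennreal (real T * (real k * \<epsilon>))) + ennreal \<alpha>"
proof -
  let ?\<sigma> = "(\<epsilon> / 4) ^ m" and ?s0 = "conf P 0 (\<lambda>_. 0)"
  let ?cost = "\<lambda>T w r. alg_cost P k ?\<sigma> X A ?s0 T w r"
  have s0: "?s0 \<in> configs P k X" by (rule conf_in_configs)
  obtain \<alpha> where meas: "\<And>T. (\<lambda>(w, r). ?cost T w r) \<in> borel_measurable (seed A \<Otimes>\<^sub>M law P T)"
    and le: "\<And>T. (\<integral>\<^sup>+(w, r). ?cost T w r \<partial>(seed A \<Otimes>\<^sub>M law P T))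
      \<le> ennreal c * (\<integral>\<^sup>+r. opt_cost P k X ?s0 T r \<partial>law P T) + ennreal \<alpha>"
    using comp s0 Q smooth_adversary_request_dist unfolding competitive_def by metis
  interpret A: prob_space "seed A" using A by (simp add: randomized_online_algorithm_def)
  have "ennreal (real T / (2 * real (Suc k))) \<le> ennreal c *
    (6 * (\<integral>\<^sup>+js. ennreal (real (hole_cost (Suc k) js)) \<partial>coupons (Suc k) T) + ennreal (real T * (real k * \<epsilon>))) + ennreal \<alpha>" for T
  proof -
    interpret law: prob_space "law P T" by (rule prob_space_law)
    have "ennreal (real T / (2 * real (Suc k))) \<le> (\<integral>\<^sup>+r. ?cost T w r \<partial>law P T)" if "w \<in> space (seed A)" for w
    proof -
      have "?cost T w \<in> borel_measurable (law P T)" for T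
        using measurable_compose[OF measurable_Pair1'[OF that] meas[of T]] by simp
      then show ?thesis
        using expected_path_cost_ge[OF s0, of "\<lambda>rs. decide A k ?\<sigma> X ?s0 w rs" T]
        unfolding alg_cost_def alg_path_def[abs_def] by simp
    qed
    then have "(\<integral>\<^sup>+w. ennreal (real T / (2 * real (Suc k))) \<partial>seed A) \<le> (\<integral>\<^sup>+w. (\<integral>\<^sup>+r. ?cost T w r \<partial>law P T) \<partial>seed A)"
      by (rule nn_integral_mono)
    then have "ennreal (real T / (2 * real (Suc k))) \<le> (\<integral>\<^sup>+w. (\<integral>\<^sup>+r. ?cost T w r \<partial>law P T) \<partial>seed A)"
      by (simp add: A.emeasure_space_1)
    also have "\<dots> = (\<integral>\<^sup>+(w, r). ?cost T w r \<partial>(seed A \<Otimes>\<^sub>M law P T))"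
      using law.nn_integral_fst[OF meas[of T]] by simp
    also note le[of T]
    also have "ennreal c * (\<integral>\<^sup>+r. opt_cost P k X ?s0 T r \<partial>law P T) + ennreal \<alpha> \<le> ennreal c *
        (6 * (\<integral>\<^sup>+js. ennreal (real (hole_cost (Suc k) js)) \<partial>coupons (Suc k) T) + ennreal (real T * (real k * \<epsilon>))) + ennreal \<alpha>"
      by (intro add_right_mono mult_left_mono expected_opt_cost_le) simp
    finally show ?thesis .
  qed
  then show ?thesis using that by blast
qed

end

section \<open>The lower bound\<close>

lemma O_competitive_mono:
  assumes "O_competitive P I A f" "\<And>k X D. I' k X D \<Longrightarrow> I k X D"
  shows "O_competitive P I' A f"
  using assms unfolding O_competitive_def competitive_def by meson

text \<open>With \<open>n\<close> as the number of blocks, this gets rid of the additive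
  constant.\<close>

lemma slope_le_of_affine_bound:
  fixes x y b :: real
  assumes "\<And>n::nat. n * x \<le> n * y + b"
  shows "x \<le> y"
proof (rule ccontr)
  assume "\<not> x \<le> y"
  then obtain n :: nat where "b < n * (x - y)" using reals_Archimedean3[of "x - y"] by auto
  then show False using assms[of n] by (simp add: algebra_simps)
qed

text \<open>One block has \<open>a N\<close> requests; it costs an online player \<open>a / 2\<close> on average and the
  offline player a constant.\<close>

lemma competitive_ratio_ge:
  fixes A :: "'w algorithm"
  assumes a: "a \<ge> 1" and N: "N = 16 ^ a" and c: "0 \<le> c"
    and A: "randomized_online_algorithm A"
    and comp: "competitive P (N - 1) ((1 / N ^ 3 / 4) ^ (4 * a)) (cube (4 * a)) Q A c"
    and Q: "\<And>D. iid_adversary D \<Longrightarrow> Q D"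
  shows "a \<le> 38 * c"
proof -
  have "(16::nat) ^ 1 \<le> 16 ^ a" using a by (intro power_increasing) auto
  then have N16: "N \<ge> 16" using N by simp
  define k where "k = N - 1"
  define \<epsilon> where "\<epsilon> = 1 / real N ^ 3"
  have Suc_k: "Suc k = N" using N16 by (simp add: k_def)
  have pow: "16 ^ a = (2::nat) ^ (4 * a)" by (simp add: power_mult)
  have "real N ^ 1 \<le> real N ^ 3" using N16 by (intro power_increasing) auto
  moreover have "16 \<le> real N" using N16 by simp
  ultimately have "2 \<le> real N ^ 3" unfolding power_one_right by linarith
  then have "0 < \<epsilon>" "\<epsilon> \<le> 1 / 2" using N16 by (simp_all add: \<epsilon>_def field_simps)
  with pow interpret hard_instance "4 * a" k \<epsilon>
    using a Suc_k N by unfold_locales simp_all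
  have Q': "Q (\<lambda>_ _. request_dist P)" by (rule Q) (auto simp: iid_adversary_def)
  obtain \<alpha> where \<alpha>: "\<And>T. ennreal (real T / (2 * real N)) \<le> ennreal c *
      (6 * (\<integral>\<^sup>+js. ennreal (real (hole_cost N js)) \<partial>coupons N T) +
       ennreal (real T * (real k * \<epsilon>))) + ennreal \<alpha>"
    using competitive_imp_bound[OF A comp[folded k_def \<epsilon>_def] Q', unfolded Suc_k] by blast
  \<comment> \<open>A block costs the offline player at most 6 * 3 for the hole and 1 for the noise,
    in total 19. The remaining \<open>6 * c\<close> stems from the additive 1 in
    \<open>expected_hole_cost\<close>.\<close>
  have "real B * (a / 2) \<le> real B * (19 * c) + (6 * c + max 0 \<alpha>)" for B
  proof -
    let ?T = "B * (a * N)"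
    have "real a < 2 ^ a" by (simp add: of_nat_less_two_power)
    also have "(2::real) ^ a \<le> 16 ^ a" by (intro power_mono) auto
    finally have "real a \<le> N" by (simp add: N)
    \<comment> \<open>Both \<open>a\<close> and \<open>k\<close> are at most \<open>N\<close>, so
      \<open>\<epsilon> = 1 / N ^ 3\<close> limits the noise cost of the \<open>a * N\<close>
      requests of a block to 1.\<close>
    have "a * N * (k * \<epsilon>) \<le> N * N * (N * \<epsilon>)"
      using \<epsilon> \<open>real a \<le> N\<close> Suc_k by (intro mult_mono) auto
    also have "\<dots> = 1" using N16 by (simp add: \<epsilon>_def power3_eq_cube)
    finally have "real B * (a * N * (k * \<epsilon>)) \<le> real B * 1" by (intro mult_left_mono) auto
    then have noise: "real ?T * (real k * \<epsilon>) \<le> B" by (simp add: mult.assoc)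
    have "ennreal (real B * (a / 2)) = ennreal (real ?T / (2 * real N))"
      using N16 by simp
    also note \<alpha>[of ?T]
    also have "ennreal c * (6 * (\<integral>\<^sup>+js. ennreal (real (hole_cost N js)) \<partial>coupons N ?T) +
        ennreal (real ?T * (real k * \<epsilon>))) + ennreal \<alpha>
        \<le> ennreal c * (6 * ennreal (1 + 3 * real B) + ennreal (real B)) + ennreal (max 0 \<alpha>)"
      using noise expected_hole_cost[OF a N, of B]
      by (intro add_mono mult_left_mono ennreal_leI) simp_all
    also have "6 * ennreal (1 + 3 * real B) = ennreal (6 * (1 + 3 * real B))"
      by (subst ennreal_mult) simp_all
    also have "ennreal (6 * (1 + 3 * real B)) + ennreal (real B) = ennreal (6 + 19 * real B)"
      by (subst ennreal_plus[symmetric]) simp_all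
    also have "ennreal c * ennreal (6 + 19 * real B) + ennreal (max 0 \<alpha>) =
        ennreal (c * (6 + 19 * real B) + max 0 \<alpha>)"
      using c by (simp add: ennreal_mult ennreal_plus)
    finally have "real B * (a / 2) \<le> c * (6 + 19 * real B) + max 0 \<alpha>"
      using c by (subst (asm) ennreal_le_iff) auto
    then show ?thesis by (simp add: algebra_simps)
  qed
  then have "a / 2 \<le> 19 * c" by (rule slope_le_of_affine_bound)
  then show ?thesis by simp
qed

text \<open>The logarithm of \<open>1 / \<sigma>\<close> is quadratic in \<open>a\<close>: there are
  \<open>4 * a\<close> coordinates, and each contributes \<open>12 * a + 2\<close> bits of
  \<open>4 * N ^ 3\<close>.\<close>

lemma ln_ratio_bounds:
  fixes a :: nat
  assumes a: "a \<ge> 1" and N: "N = 16 ^ a"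
  defines "\<sigma> \<equiv> (1 / real N ^ 3 / 4) ^ (4 * a)"
  shows "0 < \<sigma>" "\<sigma> \<le> 1" "1 \<le> ln (real (N - 1) / \<sigma>)" "ln (real (N - 1) / \<sigma>) \<le> 96 * real a ^ 2"
    "real (4 * a) \<le> 4 * ln (real (N - 1))"
proof -
  have "(16::nat) ^ 1 \<le> 16 ^ a" using a by (intro power_increasing) auto
  then have N16: "N \<ge> 16" using N by simp
  have N2: "real N = 2 ^ (4 * a)" by (simp add: N power_mult)
  show "0 < \<sigma>" using N16 by (simp add: \<sigma>_def)
  have "1 / real N ^ 3 / 4 \<le> 1" using N16 by (simp add: field_simps one_le_power order_trans[of 1 4])
  then show "\<sigma> \<le> 1" unfolding \<sigma>_def by (intro power_le_one) simp_all
  have k: "real (N - 1) \<ge> 15" using N16 by simp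
  have "exp 1 \<le> (3::real)" by (rule exp_le)
  also have "3 \<le> real (N - 1) / 1" using k by simp
  also have "\<dots> \<le> real (N - 1) / \<sigma>"
    using \<open>0 < \<sigma>\<close> \<open>\<sigma> \<le> 1\<close> by (intro divide_left_mono) simp_all
  finally show "1 \<le> ln (real (N - 1) / \<sigma>)" using k \<open>0 < \<sigma>\<close> by (subst ln_ge_iff) simp_all
  have \<sigma>: "1 / \<sigma> = 2 ^ ((12 * a + 2) * (4 * a))"
  proof -
    have "1 / \<sigma> = (4 * real N ^ 3) ^ (4 * a)" by (simp add: \<sigma>_def power_one_over field_simps)
    also have "4 * real N ^ 3 = 2 ^ (12 * a + 2)" by (simp add: N2 power_add power_mult[symmetric])
    finally show ?thesis by (simp only: power_mult)
  qed
  have "real (N - 1) / \<sigma> \<le> real N * (1 / \<sigma>)"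
    using \<open>0 < \<sigma>\<close> by (simp add: divide_right_mono)
  also have "\<dots> = 2 ^ (4 * a + (12 * a + 2) * (4 * a))" unfolding \<sigma> N2 by (simp only: power_add)
  finally have "ln (real (N - 1) / \<sigma>) \<le> ln (2 ^ (4 * a + (12 * a + 2) * (4 * a)))"
    using k \<open>0 < \<sigma>\<close> by (subst ln_le_cancel_iff) simp_all
  also have "\<dots> = real (4 * a + (12 * a + 2) * (4 * a)) * ln 2" by (simp add: ln_realpow)
  also have "\<dots> \<le> real (4 * a + (12 * a + 2) * (4 * a)) * 1"
    using ln_2_less_1 by (intro mult_left_mono) simp_all
  also have "\<dots> = 12 * real a + 48 * real a ^ 2" by (simp add: power2_eq_square algebra_simps)
  also have "\<dots> \<le> 96 * real a ^ 2"
  proof -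
    have "real a \<le> real a ^ 2" using a by (intro self_le_power) simp_all
    then show ?thesis by linarith
  qed
  finally show "ln (real (N - 1) / \<sigma>) \<le> 96 * real a ^ 2" .
  \<comment> \<open>\<open>N - 1\<close> is at least \<open>N / 2 = 2 ^ (4 * a - 1)\<close>, which
    avoids a logarithm of \<open>N - 1\<close> itself.\<close>
  have "4 * a = Suc (4 * a - 1)" using a by simp
  then have "(2::real) ^ (4 * a) = 2 * 2 ^ (4 * a - 1)" by (metis power_Suc)
  then have "(2::real) ^ (4 * a - 1) \<le> real (N - 1)" using N16 N2 by (simp add: of_nat_diff)
  then have "ln (2 ^ (4 * a - 1)) \<le> ln (real (N - 1))" using k by (subst ln_le_cancel_iff) simp_all
  then have "(4 * real a - 1) * ln 2 \<le> ln (real (N - 1))" using a by (simp add: ln_realpow of_nat_diff)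
  moreover have "(4 * real a - 1) * (2 / 3) \<le> (4 * real a - 1) * ln 2"
    using a ln2_ge_two_thirds by (intro mult_left_mono) simp_all
  ultimately show "real (4 * a) \<le> 4 * ln (real (N - 1))" using a by simp
qed

text \<open>The ratio is at least \<open>a / 38\<close>, while the logarithm is at most
  \<open>96 * a ^ 2\<close>. So \<open>a\<close> would be at most a constant times
  \<open>a powr (2 * \<gamma>)\<close> with \<open>2 * \<gamma> < 1\<close>, which fails for large
  \<open>a\<close>.\<close>

lemma not_O_competitive_iid:
  fixes A :: "'w algorithm" and c :: real
  assumes c: "c < 1 / 2" and A: "randomized_online_algorithm A"
  shows "\<not> O_competitive P
    (\<lambda>k X D. is_linf_ball X \<and> real (dim X) \<le> 4 * ln (real k) \<and> iid_adversary D)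
    A (\<lambda>k \<sigma>. ln (real k / \<sigma>) powr c)"
proof
  assume "O_competitive P
    (\<lambda>k X D. is_linf_ball X \<and> real (dim X) \<le> 4 * ln (real k) \<and> iid_adversary D)
    A (\<lambda>k \<sigma>. ln (real k / \<sigma>) powr c)"
  then obtain C where C: "C > 0" and comp: "\<And>k \<sigma> X. \<lbrakk>k \<ge> 2; 0 < \<sigma>; \<sigma> \<le> 1; metric_setting X\<rbrakk> \<Longrightarrow>
      competitive P k \<sigma> X
        (\<lambda>D. is_linf_ball X \<and> real (dim X) \<le> 4 * ln (real k) \<and> iid_adversary D) A
        (C * ln (real k / \<sigma>) powr c)"
    unfolding O_competitive_def by meson
  \<comment> \<open>An upper bound on the logarithm carries over to its power only for a nonnegative
    exponent. As the logarithm is at least 1, raising \<open>c\<close> to \<open>\<gamma>\<close>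
    only weakens the claimed ratio.\<close>
  define \<gamma> where "\<gamma> = max c 0"
  have \<gamma>: "0 \<le> \<gamma>" "c \<le> \<gamma>" "0 < 1 - 2 * \<gamma>" using c by (auto simp: \<gamma>_def)
  define E where "E = 38 * C * 96 powr \<gamma>"
  have "E > 0" using C by (simp add: E_def)
  have le: "real a powr (1 - 2 * \<gamma>) \<le> E" if a: "a \<ge> 1" for a :: nat
  proof -
    define N :: nat where "N = 16 ^ a"
    define \<sigma> where "\<sigma> = (1 / real N ^ 3 / 4) ^ (4 * a)"
    note bounds = ln_ratio_bounds[OF a N_def, folded \<sigma>_def]
    have "(16::nat) ^ 1 \<le> 16 ^ a" using a by (intro power_increasing) auto
    then have N16: "N \<ge> 16" by (simp add: N_def)
    have m: "4 * a \<ge> 1" using a by simp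
    have "competitive P (N - 1) \<sigma> (cube (4 * a))
        (\<lambda>D. is_linf_ball (cube (4 * a)) \<and> real (dim (cube (4 * a))) \<le> 4 * ln (real (N - 1)) \<and>
          iid_adversary D) A (C * ln (real (N - 1) / \<sigma>) powr c)"
      using N16 bounds by (intro comp metric_setting_cube[OF m]) simp_all
    then have "real a \<le> 38 * (C * ln (real (N - 1) / \<sigma>) powr c)"
      unfolding \<sigma>_def using C bounds(5) is_linf_ball_cube[OF m]
      by (elim competitive_ratio_ge[OF a N_def _ A, rotated]) simp_all
    also have "ln (real (N - 1) / \<sigma>) powr c \<le> ln (real (N - 1) / \<sigma>) powr \<gamma>"
      using bounds(3) \<gamma> by (intro powr_mono) auto
    also have "\<dots> \<le> (96 * real a ^ 2) powr \<gamma>"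
      using bounds(3,4) \<gamma> by (intro powr_mono2) auto
    also have "\<dots> = 96 powr \<gamma> * real a powr (2 * \<gamma>)"
      using a by (simp add: powr_mult powr_powr[symmetric] flip: powr_numeral)
    finally have "real a \<le> E * real a powr (2 * \<gamma>)"
      using C by (simp add: E_def mult.assoc)
    moreover have "real a = real a powr (1 - 2 * \<gamma>) * real a powr (2 * \<gamma>)"
      using a by (simp flip: powr_add)
    ultimately have "real a powr (1 - 2 * \<gamma>) * real a powr (2 * \<gamma>) \<le> E * real a powr (2 * \<gamma>)"
      by simp
    then show ?thesis using a by (simp add: mult_le_cancel_right)
  qed
  \<comment> \<open>The threshold solves \<open>a powr (1 - 2 * \<gamma>) = E\<close> for
    \<open>a\<close>.\<close>
  obtain a :: nat where a: "max 1 (E powr (1 / (1 - 2 * \<gamma>))) < a"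
    using reals_Archimedean2 by blast
  have "E = (E powr (1 / (1 - 2 * \<gamma>))) powr (1 - 2 * \<gamma>)"
    using \<open>E > 0\<close> \<gamma> by (simp add: powr_powr)
  also have "\<dots> < real a powr (1 - 2 * \<gamma>)" using a \<gamma> by (intro powr_less_mono2) auto
  finally show False using le[of a] a by simp
qed

text \<open>The witness \<open>K = 4\<close> comes from comparing the dimension \<open>4 * a\<close>
  with \<open>ln (16 ^ a - 1)\<close>. The unrestricted claim reduces to the restricted one by
  \<open>O_competitive_mono\<close>.\<close>

theorem theorem1p5:
  shows "\<exists>K::real. K > 0 \<and> (\<forall>P. \<forall>c::real. c < 1/2 \<longrightarrow>
    \<not> (\<exists>A::'w algorithm. randomized_online_algorithm A \<and>
         O_competitive P (\<lambda>k X D. True) A (\<lambda>k \<sigma>. ln (real k / \<sigma>) powr c)) \<and>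
    \<not> (\<exists>A::'w algorithm. randomized_online_algorithm A \<and>
         O_competitive P
           (\<lambda>k X D. is_linf_ball X \<and> real (dim X) \<le> K * ln (real k) \<and> iid_adversary D)
           A (\<lambda>k \<sigma>. ln (real k / \<sigma>) powr c)))"
proof (intro exI[of _ 4] conjI allI impI notI; (elim exE conjE)?)
  fix P and c :: real and A :: "'w algorithm"
  assume "c < 1/2" "randomized_online_algorithm A"
  note not = not_O_competitive_iid[OF this, of P]
  show False if "O_competitive P (\<lambda>k X D. True) A (\<lambda>k \<sigma>. ln (real k / \<sigma>) powr c)"
    using not O_competitive_mono[OF that] by blast
  show False if "O_competitive P
      (\<lambda>k X D. is_linf_ball X \<and> real (dim X) \<le> 4 * ln (real k) \<and> iid_adversary D)
      A (\<lambda>k \<sigma>. ln (real k / \<sigma>) powr c)"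
    using not that by blast
qed simp

end
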